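(* Let $\Omega\subset\mathbb{R}^n$ ($n\ge 1$) be a bounded open set, let $a_{ij}, r_k, q_1, q_2\in L^\infty(\Omega)$ be real-valued ($1\le i,j,k\le n$), let $\mathfrak{P}=(a_{ij})_{n\times n}$ be symmetric, and let $\mathfrak{R}=(r_k)_{n\times 1}$. Assume that there exists $\alpha>0$ such that, for a.e. $x\in\Omega$, $$A^{T}\mathfrak{P}(x)A\ \ge\ \alpha\, A^{T}A\qquad\text{for all } A\in\mathbb{R}^n ,$$ and that $$\kappa:=\operatorname*{ess\,inf}_{x\in\Omega} q_1(x)\ \ge\ \frac{\alpha}{2}+\frac{\mathcal{B}^2}{2\alpha},\qquad \text{where } \mathcal{B}^2=\sum_{k=1}^n\|r_k\|_{L^\infty(\Omega)}^2 .$$ Then for every $\mathbf{f}=(f_1,f_2)\in (L^2(\Omega))^2$ there exists a unique $\mathbf{u}=(u_1,u_2)\in V:=(H_0^1(\Omega))^2$ such that $$a(\mathbf{u},\mathbf{v})=\langle \mathbf{f},\mathbf{v}\rangle\qquad\text{for every }\mathbf{v}\in V,$$ where $a$ is the bilinear form defined in the context and $\langle\mathbf{f},\mathbf{v}\rangle=\int_\Omega (f_1v_1+f_2v_2)\,dx$.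
   Context: For $\mathbf{u}=(u_1,u_2)$, $\mathbf{v}=(v_1,v_2)$ in $V=(H_0^1(\Omega))^2$ (real-valued functions, product norm $\|(u_1,u_2)\|_V=\|u_1\|_{H^1(\Omega)}+\|u_2\|_{H^1(\Omega)}$), the bilinear form is $$a(\mathbf{u},\mathbf{v})=\int_\Omega\big[(\nabla v_1)^T\mathfrak{P}\nabla u_1+(\nabla v_2)^T\mathfrak{P}\nabla u_2\big]dx+\int_\Omega\big[v_1\,\mathfrak{R}\cdot\nabla u_1+v_2\,\mathfrak{R}\cdot\nabla u_2\big]dx+\int_\Omega\big[(q_1u_1+q_2u_2)v_1+(q_1u_2-q_2u_1)v_2\big]dx ,$$ with gradients regarded as column vectors. This is the weak form of the coupled elliptic system $$-\nabla\cdot(\mathfrak{P}\nabla u_1)+\mathfrak{R}\cdot\nabla u_1+q_1u_1+q_2u_2=f_1,\qquad -\nabla\cdot(\mathfrak{P}\nabla u_2)+\mathfrak{R}\cdot\nabla u_2+q_1u_2-q_2u_1=f_2\quad\text{in }\Omega,$$ with $u_1=u_2=0$ on $\partial\Omega$. *)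

theory Defs
  imports "HOL-Analysis.Analysis" "HOL-Probability.Essential_Supremum"
begin

text \<open>
  Elements of Lebesgue and Sobolev spaces on an open set \<open>\<Omega>\<close> are represented by functions on the
  whole of \<open>real ^ 'n\<close>, of which only the values on \<open>\<Omega>\<close> matter; two functions represent the same
  element iff they agree almost everywhere on \<open>\<Omega>\<close>.
\<close>

section \<open>Lebesgue spaces\<close>

definition L2 :: "(real ^ 'n) set \<Rightarrow> (real ^ 'n \<Rightarrow> real) set" where
  "L2 \<Omega> = {f \<in> borel_measurable (lebesgue_on \<Omega>). integrable (lebesgue_on \<Omega>) (\<lambda>x. (f x)\<^sup>2)}"

definition Linfty :: "(real ^ 'n) set \<Rightarrow> (real ^ 'n \<Rightarrow> real) set" where
  "Linfty \<Omega> = {f \<in> borel_measurable (lebesgue_on \<Omega>).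
     esssup (lebesgue_on \<Omega>) (\<lambda>x. ereal \<bar>f x\<bar>) < \<infinity>}"

definition Linfty_norm :: "(real ^ 'n) set \<Rightarrow> (real ^ 'n \<Rightarrow> real) \<Rightarrow> real" where
  "Linfty_norm \<Omega> f = real_of_ereal (esssup (lebesgue_on \<Omega>) (\<lambda>x. ereal \<bar>f x\<bar>))"

definition essinf :: "'a measure \<Rightarrow> ('a \<Rightarrow> ereal) \<Rightarrow> ereal" where
  "essinf M f = Sup {c. AE x in M. c \<le> f x}"

section \<open>Test functions\<close>

definition partial :: "'n \<Rightarrow> (real ^ 'n \<Rightarrow> real) \<Rightarrow> real ^ 'n \<Rightarrow> real" where
  "partial i f x = frechet_derivative f (at x) (axis i 1)"

primrec Ck :: "nat \<Rightarrow> (real ^ 'n \<Rightarrow> real) \<Rightarrow> bool" where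
  "Ck 0 f \<longleftrightarrow> continuous_on UNIV f"
| "Ck (Suc k) f \<longleftrightarrow> (\<forall>x. f differentiable (at x)) \<and> (\<forall>i. Ck k (partial i f))"

definition test_functions :: "(real ^ 'n) set \<Rightarrow> (real ^ 'n \<Rightarrow> real) set" where
  "test_functions \<Omega> = {\<phi>. (\<forall>k. Ck k \<phi>) \<and>
     compact (closure {x. \<phi> x \<noteq> 0}) \<and> closure {x. \<phi> x \<noteq> 0} \<subseteq> \<Omega>}"

section \<open>Sobolev spaces\<close>

definition has_weak_grad ::
    "(real ^ 'n) set \<Rightarrow> (real ^ 'n \<Rightarrow> real) \<Rightarrow> (real ^ 'n \<Rightarrow> real ^ 'n) \<Rightarrow> bool" where
  "has_weak_grad \<Omega> u g \<longleftrightarrow> u \<in> L2 \<Omega> \<and> (\<forall>i. (\<lambda>x. g x $ i) \<in> L2 \<Omega>) \<and>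
     (\<forall>\<phi>\<in>test_functions \<Omega>. \<forall>i.
        (\<integral>x. u x * partial i \<phi> x \<partial>lebesgue_on \<Omega>) = - (\<integral>x. g x $ i * \<phi> x \<partial>lebesgue_on \<Omega>))"

definition H1 :: "(real ^ 'n) set \<Rightarrow> (real ^ 'n \<Rightarrow> real) set" where
  "H1 \<Omega> = {u. \<exists>g. has_weak_grad \<Omega> u g}"

text \<open>
  The weak gradient is determined only up to a null set of \<open>\<Omega>\<close>; the choice made here does not
  affect any integral over \<open>\<Omega>\<close> that involves it.
\<close>

definition weak_grad ::
    "(real ^ 'n) set \<Rightarrow> (real ^ 'n \<Rightarrow> real) \<Rightarrow> real ^ 'n \<Rightarrow> real ^ 'n" where
  "weak_grad \<Omega> u = (SOME g. has_weak_grad \<Omega> u g)"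

definition H1_norm :: "(real ^ 'n) set \<Rightarrow> (real ^ 'n \<Rightarrow> real) \<Rightarrow> real" where
  "H1_norm \<Omega> u = sqrt ((\<integral>x. (u x)\<^sup>2 \<partial>lebesgue_on \<Omega>) +
     (\<integral>x. (norm (weak_grad \<Omega> u x))\<^sup>2 \<partial>lebesgue_on \<Omega>))"

text \<open>The closure of the test functions in the \<open>H1\<close> norm.\<close>

definition H10 :: "(real ^ 'n) set \<Rightarrow> (real ^ 'n \<Rightarrow> real) set" where
  "H10 \<Omega> = {u \<in> H1 \<Omega>. \<forall>\<epsilon>>0. \<exists>\<phi>\<in>test_functions \<Omega>. H1_norm \<Omega> (\<lambda>x. u x - \<phi> x) < \<epsilon>}"

section \<open>The coupled system\<close>

type_synonym 'n fpair = "(real ^ 'n \<Rightarrow> real) \<times> (real ^ 'n \<Rightarrow> real)"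

definition V :: "(real ^ 'n) set \<Rightarrow> 'n fpair set" where
  "V \<Omega> = H10 \<Omega> \<times> H10 \<Omega>"

definition bform :: "(real ^ 'n) set \<Rightarrow> (real ^ 'n \<Rightarrow> real ^ 'n ^ 'n) \<Rightarrow> (real ^ 'n \<Rightarrow> real ^ 'n)
    \<Rightarrow> (real ^ 'n \<Rightarrow> real) \<Rightarrow> (real ^ 'n \<Rightarrow> real) \<Rightarrow> 'n fpair \<Rightarrow> 'n fpair \<Rightarrow> real" where
  "bform \<Omega> P R q1 q2 = (\<lambda>(u1, u2) (v1, v2).
     (\<integral>x. weak_grad \<Omega> v1 x \<bullet> (P x *v weak_grad \<Omega> u1 x)
         + weak_grad \<Omega> v2 x \<bullet> (P x *v weak_grad \<Omega> u2 x) \<partial>lebesgue_on \<Omega>)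
   + (\<integral>x. v1 x * (R x \<bullet> weak_grad \<Omega> u1 x)
         + v2 x * (R x \<bullet> weak_grad \<Omega> u2 x) \<partial>lebesgue_on \<Omega>)
   + (\<integral>x. (q1 x * u1 x + q2 x * u2 x) * v1 x
         + (q1 x * u2 x - q2 x * u1 x) * v2 x \<partial>lebesgue_on \<Omega>))"

definition L2_pairing :: "(real ^ 'n) set \<Rightarrow> 'n fpair \<Rightarrow> 'n fpair \<Rightarrow> real" where
  "L2_pairing \<Omega> = (\<lambda>(f1, f2) (v1, v2). \<integral>x. f1 x * v1 x + f2 x * v2 x \<partial>lebesgue_on \<Omega>)"

definition ae_eq :: "(real ^ 'n) set \<Rightarrow> 'n fpair \<Rightarrow> 'n fpair \<Rightarrow> bool" where
  "ae_eq \<Omega> u w \<longleftrightarrow> (AE x in lebesgue_on \<Omega>. fst u x = fst w x \<and> snd u x = snd w x)"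

end

theory Submission
  imports Defs "HOL-Library.Function_Algebras"
begin

text \<open>
  The theorem is an instance of the Lax-Milgram theorem. A pair \<open>(u1, u2)\<close> in \<open>V \<Omega>\<close> is encoded by
  its jet \<open>U x = ((u1 x, \<nabla>u1 x), (u2 x, \<nabla>u2 x))\<close>, a square integrable function with values in
  a Euclidean space. On jets the bilinear form is an \<open>L2\<close> inner product: \<open>a(u, v) = \<langle>T U, W\<rangle>\<close>, where
  \<open>W\<close> is the jet of \<open>v\<close> and \<open>T\<close> is the pointwise linear map \<open>coeff_op\<close> made from the coefficients.
  Since these are essentially bounded, \<open>T\<close> is bounded on \<open>L2\<close>.

  Coercivity holds pointwise (\<open>coercive_pointwise\<close>, \<open>T_coercive\<close>). In \<open>T U \<bullet> U\<close> the two
  \<open>q2\<close>-terms cancel; ellipticity gives \<open>\<alpha> |\<nabla>u|^2\<close>; and Young's inequality bounds the convection term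
  \<open>u (R \<bullet> \<nabla>u)\<close> by \<open>\<alpha>/2 |\<nabla>u|^2 + B^2/(2 \<alpha>) u^2\<close>. The lower bound on \<open>q1\<close> absorbs the last term
  and leaves \<open>\<alpha>/2 u^2\<close>, so that \<open>\<langle>T U, U\<rangle> \<ge> \<alpha>/2 \<langle>U, U\<rangle>\<close>.

  It remains to see that the jets form a complete space. Elements of \<open>L2\<close> are functions and not
  classes of functions, so the Hilbert space theory is done for positive semidefinite inner
  products, where limits and solutions are unique only up to vectors of seminorm zero
  (\<open>orthogonal_projection_exists\<close>, \<open>Lax_Milgram\<close>). Completeness of \<open>L2\<close> is the Riesz-Fischer theorem
  (\<open>scomplete_l2_space\<close>), and the space of jets is by definition the closure of the jets of test
  functions. That this closure is \<open>V \<Omega>\<close> up to null sets needs two facts. Test functions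
  have their classical gradient as weak gradient; this is integration by parts, which follows from
  translation invariance of Lebesgue measure (\<open>integral_partial_test_function\<close>). And weak
  gradients are unique almost everywhere, so that the arbitrary choice in \<open>weak_grad\<close> is harmless
  (\<open>fundamental_lemma_variations\<close>, \<open>has_weak_grad_unique\<close>).
\<close>

section \<open>Semi-inner product spaces and the Lax-Milgram theorem\<close>

text \<open>
  The form lives on a subspace \<open>L\<close> because the integral of a product of two functions is bilinear
  only where the products are integrable, and it is only semidefinite because functions that vanish
  almost everywhere have norm zero.
\<close>

locale semi_inner_space =
  fixes L :: "'a::real_vector set" and ip :: "'a \<Rightarrow> 'a \<Rightarrow> real"
  assumes subspace_L: "subspace L"
    and ip_add: "\<lbrakk>x \<in> L; y \<in> L; z \<in> L\<rbrakk> \<Longrightarrow> ip (x + y) z = ip x z + ip y z"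
    and ip_scale: "\<lbrakk>x \<in> L; y \<in> L\<rbrakk> \<Longrightarrow> ip (c *\<^sub>R x) y = c * ip x y"
    and ip_sym: "\<lbrakk>x \<in> L; y \<in> L\<rbrakk> \<Longrightarrow> ip x y = ip y x"
    and ip_nonneg: "x \<in> L \<Longrightarrow> 0 \<le> ip x x"
begin

definition snorm :: "'a \<Rightarrow> real" where
  "snorm x = sqrt (ip x x)"

definition sCauchy :: "(nat \<Rightarrow> 'a) \<Rightarrow> bool" where
  "sCauchy s \<longleftrightarrow> (\<forall>e>0. \<exists>N. \<forall>m\<ge>N. \<forall>n\<ge>N. snorm (s m - s n) < e)"

definition stends :: "(nat \<Rightarrow> 'a) \<Rightarrow> 'a \<Rightarrow> bool" where
  "stends s x \<longleftrightarrow> (\<lambda>n. snorm (s n - x)) \<longlonglongrightarrow> 0"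

definition scomplete :: "'a set \<Rightarrow> bool" where
  "scomplete S \<longleftrightarrow> (\<forall>s. (\<forall>n. s n \<in> S) \<longrightarrow> sCauchy s \<longrightarrow> (\<exists>x\<in>S. stends s x))"

lemma L_closed [simp]:
  shows "0 \<in> L"
    and "\<lbrakk>x \<in> L; y \<in> L\<rbrakk> \<Longrightarrow> x + y \<in> L"
    and "\<lbrakk>x \<in> L; y \<in> L\<rbrakk> \<Longrightarrow> x - y \<in> L"
    and "x \<in> L \<Longrightarrow> c *\<^sub>R x \<in> L"
  using subspace_L by (auto intro: subspace_0 subspace_add subspace_diff subspace_scale)

lemma ip_linear:
  shows ip_add_right: "\<lbrakk>x \<in> L; y \<in> L; z \<in> L\<rbrakk> \<Longrightarrow> ip z (x + y) = ip z x + ip z y"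
    and ip_scale_right: "\<lbrakk>x \<in> L; y \<in> L\<rbrakk> \<Longrightarrow> ip y (c *\<^sub>R x) = c * ip y x"
    and ip_diff: "\<lbrakk>x \<in> L; y \<in> L; z \<in> L\<rbrakk> \<Longrightarrow> ip (x - y) z = ip x z - ip y z"
    and ip_diff_right: "\<lbrakk>x \<in> L; y \<in> L; z \<in> L\<rbrakk> \<Longrightarrow> ip z (x - y) = ip z x - ip z y"
proof -
  show a: "ip z (x + y) = ip z x + ip z y" if "x \<in> L" "y \<in> L" "z \<in> L" for x y z
    using that by (simp add: ip_sym[of z] ip_add)
  show s: "ip y (c *\<^sub>R x) = c * ip y x" if "x \<in> L" "y \<in> L" for x y c
    using that by (simp add: ip_sym[of y] ip_scale)
  show d: "ip (x - y) z = ip x z - ip y z" if "x \<in> L" "y \<in> L" "z \<in> L" for x y z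
    using ip_add[of "x - y" y z] that by simp
  show "ip z (x - y) = ip z x - ip z y" if "x \<in> L" "y \<in> L" "z \<in> L" for x y z
    using that by (simp add: ip_sym[of z] d)
qed

lemmas ip_simps = ip_add ip_scale ip_linear

lemma snorm_nonneg: "x \<in> L \<Longrightarrow> 0 \<le> snorm x"
  by (simp add: snorm_def ip_nonneg)

lemma snorm_square: "x \<in> L \<Longrightarrow> (snorm x)\<^sup>2 = ip x x"
  by (simp add: snorm_def ip_nonneg)

lemma Cauchy_Schwarz:
  assumes x: "x \<in> L" and y: "y \<in> L"
  shows "\<bar>ip x y\<bar> \<le> snorm x * snorm y"
proof -
  have q: "0 \<le> ip x x - 2 * t * ip x y + t\<^sup>2 * ip y y" for t
  proof -
    have "ip (x - t *\<^sub>R y) (x - t *\<^sub>R y) = ip x x - 2 * t * ip x y + t\<^sup>2 * ip y y"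
      using x y by (simp add: ip_simps ip_sym[of y x] power2_eq_square algebra_simps)
    then show ?thesis using ip_nonneg[of "x - t *\<^sub>R y"] x y by simp
  qed
  have "(ip x y)\<^sup>2 \<le> ip x x * ip y y"
  proof (cases "ip y y = 0")
    case True
    have "ip x y = 0"
    proof (rule ccontr)
      assume ne: "ip x y \<noteq> 0"
      have "ip x x - 2 * ((ip x x + 1) / (2 * ip x y)) * ip x y = -1"
        using ne by (simp add: field_simps)
      then show False using q[of "(ip x x + 1) / (2 * ip x y)"] True by simp
    qed
    then show ?thesis using True by simp
  next
    case False
    then have p: "ip y y > 0" using ip_nonneg[OF y] by simp
    show ?thesis
      using q[of "ip x y / ip y y"] p by (simp add: field_simps power2_eq_square)
  qed
  then have "sqrt ((ip x y)\<^sup>2) \<le> sqrt (ip x x * ip y y)"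
    by (rule real_sqrt_le_mono)
  then show ?thesis by (simp add: snorm_def real_sqrt_mult)
qed

lemma snorm_triangle:
  assumes x: "x \<in> L" and y: "y \<in> L"
  shows "snorm (x + y) \<le> snorm x + snorm y"
proof (rule power2_le_imp_le)
  have "(snorm (x + y))\<^sup>2 = (snorm x)\<^sup>2 + 2 * ip x y + (snorm y)\<^sup>2"
    using x y by (simp add: snorm_square ip_simps ip_sym[of y x])
  also have "\<dots> \<le> (snorm x + snorm y)\<^sup>2"
    using Cauchy_Schwarz[OF x y] by (simp add: power2_sum)
  finally show "(snorm (x + y))\<^sup>2 \<le> (snorm x + snorm y)\<^sup>2" .
  show "0 \<le> snorm x + snorm y" using snorm_nonneg x y by simp
qed

lemma snorm_minus_commute:
  assumes "x \<in> L" "y \<in> L"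
  shows "snorm (x - y) = snorm (y - x)"
  using assms by (simp add: snorm_def ip_simps)

lemma snorm_triangle_diff:
  assumes "x \<in> L" "y \<in> L" "z \<in> L"
  shows "snorm (x - z) \<le> snorm (x - y) + snorm (y - z)"
  using snorm_triangle[of "x - y" "y - z"] assms by simp

lemma ip_tendsto:
  assumes s: "\<And>n. s n \<in> L" and x: "x \<in> L" and v: "v \<in> L" and st: "stends s x"
  shows "(\<lambda>n. ip (s n) v) \<longlonglongrightarrow> ip x v"
proof -
  have "(\<lambda>n. ip (s n) v - ip x v) \<longlonglongrightarrow> 0"
  proof (rule Lim_null_comparison)
    show "\<forall>\<^sub>F n in sequentially. norm (ip (s n) v - ip x v) \<le> snorm (s n - x) * snorm v"
      using Cauchy_Schwarz[of "s _ - x" v] s x v by (simp add: ip_simps)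
    show "(\<lambda>n. snorm (s n - x) * snorm v) \<longlonglongrightarrow> 0"
      using st unfolding stends_def by (rule tendsto_mult_left_zero)
  qed
  then show ?thesis by (simp add: LIM_zero_iff)
qed

lemma snorm_scaleR: "x \<in> L \<Longrightarrow> snorm (a *\<^sub>R x) = \<bar>a\<bar> * snorm x"
  by (simp add: snorm_def ip_simps real_sqrt_mult flip: mult.assoc power2_eq_square)

lemma snorm_zero [simp]: "snorm 0 = 0"
  using snorm_scaleR[of 0 0] by simp

definition sclosure :: "'a set \<Rightarrow> 'a set" where
  "sclosure D = {x \<in> L. \<forall>e>0. \<exists>d\<in>D. snorm (x - d) < e}"

lemma sclosureI: "\<lbrakk>x \<in> L; \<And>e. e > 0 \<Longrightarrow> \<exists>d\<in>D. snorm (x - d) < e\<rbrakk> \<Longrightarrow> x \<in> sclosure D"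
  by (simp add: sclosure_def)

lemma sclosureD: "\<lbrakk>x \<in> sclosure D; e > 0\<rbrakk> \<Longrightarrow> \<exists>d\<in>D. snorm (x - d) < e"
  by (simp add: sclosure_def)

lemma sclosure_subset: "sclosure D \<subseteq> L"
  by (auto simp: sclosure_def)

lemma subspace_sclosure:
  assumes D: "subspace D" "D \<subseteq> L"
  shows "subspace (sclosure D)"
proof (rule subspaceI)
  show "0 \<in> sclosure D"
    by (rule sclosureI) (auto intro!: bexI[of _ 0] subspace_0[OF D(1)])
  show "x + y \<in> sclosure D" if xyD: "x \<in> sclosure D" "y \<in> sclosure D" for x y
  proof (rule sclosureI)
    have xy: "x \<in> L" "y \<in> L" using xyD sclosure_subset by auto
    then show "x + y \<in> L" by simp
    fix e :: real assume "e > 0"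
    then have "e / 2 > 0" by simp
    then obtain a b where ab: "a \<in> D" "snorm (x - a) < e / 2" "b \<in> D" "snorm (y - b) < e / 2"
      using xyD sclosureD by meson
    have "snorm ((x - a) + (y - b)) \<le> snorm (x - a) + snorm (y - b)"
      using xy ab D(2) by (intro snorm_triangle) auto
    also have "\<dots> < e" using ab by simp
    finally have "snorm (x + y - (a + b)) < e" by (simp add: algebra_simps)
    then show "\<exists>d\<in>D. snorm (x + y - d) < e" using subspace_add[OF D(1)] ab by blast
  qed
  show "c *\<^sub>R x \<in> sclosure D" if xD: "x \<in> sclosure D" for c x
  proof (rule sclosureI)
    have x: "x \<in> L" using xD sclosure_subset by auto
    then show "c *\<^sub>R x \<in> L" by simp
    fix e :: real assume "e > 0"
    then have "e / (\<bar>c\<bar> + 1) > 0" by simp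
    then obtain a where a: "a \<in> D" "snorm (x - a) < e / (\<bar>c\<bar> + 1)"
      using xD sclosureD by meson
    have "snorm (c *\<^sub>R x - c *\<^sub>R a) = \<bar>c\<bar> * snorm (x - a)"
      using snorm_scaleR[of "x - a" c] x a D(2) by (simp add: scaleR_diff_right subsetD)
    also have "\<dots> \<le> (\<bar>c\<bar> + 1) * snorm (x - a)"
      using snorm_nonneg[of "x - a"] x a D(2) by (intro mult_right_mono) auto
    also have "\<dots> < e" using a(2) pos_less_divide_eq[of "\<bar>c\<bar> + 1"] by (simp add: mult.commute add_nonneg_pos)
    finally show "\<exists>d\<in>D. snorm (c *\<^sub>R x - d) < e" using subspace_scale[OF D(1) a(1)] by blast
  qed
qed

lemma scomplete_sclosure:
  assumes L: "scomplete L" and D: "D \<subseteq> L"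
  shows "scomplete (sclosure D)"
  unfolding scomplete_def
proof (intro allI impI)
  fix s assume s: "\<forall>n. s n \<in> sclosure D" and "sCauchy s"
  have sL: "s n \<in> L" for n using s sclosure_subset by auto
  then obtain x where x: "x \<in> L" "stends s x"
    using L \<open>sCauchy s\<close> unfolding scomplete_def by blast
  have "x \<in> sclosure D"
  proof (rule sclosureI[OF x(1)])
    fix e :: real assume "e > 0"
    then have e: "e / 2 > 0" by simp
    then obtain n where n: "norm (snorm (s n - x) - 0) < e / 2"
      using x(2) unfolding stends_def LIMSEQ_iff by blast
    obtain d where d: "d \<in> D" "snorm (s n - d) < e / 2"
      using s sclosureD e by meson
    have "snorm (x - d) \<le> snorm (x - s n) + snorm (s n - d)"
      using x sL d D by (intro snorm_triangle_diff) auto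
    also have "\<dots> < e" using n d snorm_minus_commute[OF sL x(1), of n] by simp
    finally show "\<exists>d\<in>D. snorm (x - d) < e" using d(1) by blast
  qed
  with x(2) show "\<exists>x\<in>sclosure D. stends s x" by blast
qed

text \<open>
  The usual minimisation argument. A minimising sequence for the distance from \<open>x\<close> to \<open>S\<close> is Cauchy
  by the parallelogram law, and at its limit \<open>y\<close> the distance cannot decrease along any \<open>v\<close> in \<open>S\<close>,
  which forces \<open>x - y\<close> to be orthogonal to \<open>v\<close>.
\<close>

theorem orthogonal_projection_exists:
  assumes S: "subspace S" "S \<subseteq> L" "scomplete S" and x: "x \<in> L"
  obtains y where "y \<in> S" "\<And>v. v \<in> S \<Longrightarrow> ip (x - y) v = 0"
proof -
  define Q where "Q y = ip (x - y) (x - y)" for y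
  define d where "d = (INF y\<in>S. Q y)"
  have SL: "y \<in> L" if "y \<in> S" for y using that S by auto
  have bdd: "bdd_below (Q ` S)"
    unfolding Q_def using ip_nonneg SL x by (intro bdd_belowI[of _ 0]) auto
  have dle: "d \<le> Q y" if "y \<in> S" for y
    unfolding d_def by (rule cINF_lower[OF bdd that])
  have ne: "S \<noteq> {}" using subspace_0[OF S(1)] by auto
  have "\<exists>y\<in>S. Q y < d + inverse (Suc n)" for n
    using cINF_less_iff[OF ne bdd, of "d + inverse (Suc n)"] by (simp add: d_def)
  then obtain s where sS: "\<And>n. s n \<in> S" and sd: "\<And>n. Q (s n) < d + inverse (Suc n)"
    by metis
  have par: "ip (s m - s n) (s m - s n) \<le> 2 * inverse (Suc m) + 2 * inverse (Suc n)" for m n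
  proof -
    let ?h = "(1/2) *\<^sub>R (s m + s n)"
    have h: "?h \<in> S" using S(1) sS by (simp add: subspace_add subspace_scale)
    have "ip (s m - s n) (s m - s n) = 2 * Q (s m) + 2 * Q (s n) - 4 * Q ?h"
      unfolding Q_def using x SL[OF sS[of m]] SL[OF sS[of n]]
      by (simp add: ip_simps ip_sym[of "s m" x] ip_sym[of "s n" x] ip_sym[of "s n" "s m"]
          algebra_simps)
    then show ?thesis using sd[of m] sd[of n] dle[OF h] by simp
  qed
  have "sCauchy s"
    unfolding sCauchy_def
  proof (intro allI impI)
    fix e :: real assume e: "e > 0"
    then obtain N where N: "inverse (Suc N) < e\<^sup>2 / 4"
      using reals_Archimedean[of "e\<^sup>2 / 4"] by auto
    have "snorm (s m - s n) < e" if "m \<ge> N" "n \<ge> N" for m n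
    proof -
      have "inverse (Suc m) \<le> inverse (real (Suc N))" "inverse (Suc n) \<le> inverse (real (Suc N))"
        using that by (simp_all add: field_simps)
      then have "ip (s m - s n) (s m - s n) < e\<^sup>2"
        using par[of m n] N by linarith
      then show ?thesis
        unfolding snorm_def using e real_sqrt_less_mono by fastforce
    qed
    then show "\<exists>N. \<forall>m\<ge>N. \<forall>n\<ge>N. snorm (s m - s n) < e" by blast
  qed
  then obtain y where y: "y \<in> S" "stends s y"
    using S(3) sS unfolding scomplete_def by blast
  have "snorm (x - y) \<le> sqrt d"
  proof (rule LIMSEQ_le_const)
    have "(\<lambda>n. sqrt (d + inverse (Suc n)) + snorm (s n - y)) \<longlonglongrightarrow> sqrt (d + 0) + 0"
      using y(2) unfolding stends_def
      by (intro tendsto_intros LIMSEQ_inverse_real_of_nat) auto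
    then show "(\<lambda>n. sqrt (d + inverse (Suc n)) + snorm (s n - y)) \<longlonglongrightarrow> sqrt d" by simp
    have "snorm (x - y) \<le> sqrt (d + inverse (Suc n)) + snorm (s n - y)" for n
    proof -
      have "snorm (x - s n) \<le> sqrt (d + inverse (Suc n))"
        unfolding snorm_def using sd[of n] by (simp add: Q_def)
      then show ?thesis
        using snorm_triangle_diff[of x "s n" y] x SL sS y(1) by (smt (verit))
    qed
    then show "\<exists>N. \<forall>n\<ge>N. snorm (x - y) \<le> sqrt (d + inverse (Suc n)) + snorm (s n - y)" by blast
  qed
  then have Qy: "Q y \<le> d" by (simp add: snorm_def Q_def)
  have "ip (x - y) v = 0" if v: "v \<in> S" for v
  proof (rule ccontr)
    assume ne: "ip (x - y) v \<noteq> 0"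
    define c where "c = ip (x - y) v"
    define q where "q = ip v v"
    have q0: "q \<ge> 0" unfolding q_def using ip_nonneg SL v by simp
    have *: "2 * t * c \<le> t\<^sup>2 * q" for t
    proof -
      have "Q (y + t *\<^sub>R v) = Q y - 2 * t * c + t\<^sup>2 * q"
        unfolding Q_def c_def q_def using x SL[OF y(1)] SL[OF v]
        by (simp add: ip_simps ip_sym[of v x] ip_sym[of v y] ip_sym[of y x]
            power2_eq_square algebra_simps)
      moreover have "y + t *\<^sub>R v \<in> S" using S(1) y v by (simp add: subspace_add subspace_scale)
      ultimately show ?thesis using dle[of "y + t *\<^sub>R v"] Qy by simp
    qed
    have c2: "c\<^sup>2 > 0" using ne c_def by simp
    \<comment> \<open>The optimal step would be c / q; adding 1 keeps it meaningful when q = 0.\<close>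
    have "2 * (c / (q + 1)) * c \<le> (c / (q + 1))\<^sup>2 * q" by (rule *)
    then have "2 * c\<^sup>2 * (q + 1) \<le> c\<^sup>2 * q"
      using q0 by (simp add: power2_eq_square divide_simps split: if_splits)
    then have "2 * (q + 1) \<le> q"
      using c2 by (simp add: mult.assoc mult.left_commute)
    then show False using q0 by simp
  qed
  then show ?thesis by (rule that[OF y(1)])
qed

text \<open>
  Stating the theorem with \<open>ip (T u) v\<close> on one side and \<open>ip f v\<close> on the other removes the need for
  the Riesz representation theorem. Let \<open>S'\<close> be the range of the compression of \<open>T\<close> to \<open>S\<close>. Coercivity
  bounds preimages by images, so \<open>S'\<close> is complete and \<open>f\<close> has a projection \<open>w\<close> onto it. Let
  \<open>z\<close> be the projection of the residual \<open>f - w\<close> onto \<open>S\<close>, and \<open>y\<close> that of \<open>T z\<close>, which lies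
  in \<open>S'\<close>. Then \<open>c |z|^2 \<le> ip (T z) z = ip y z = ip (f - w) y = 0\<close>, so \<open>f - w\<close> is orthogonal to
  all of \<open>S\<close>, and any preimage of \<open>w\<close> is a solution.
\<close>

theorem Lax_Milgram:
  assumes S: "subspace S" "S \<subseteq> L" "scomplete S"
    and TL: "\<And>u. u \<in> S \<Longrightarrow> T u \<in> L"
    and T_add: "\<And>u v. \<lbrakk>u \<in> S; v \<in> S\<rbrakk> \<Longrightarrow> T (u + v) = T u + T v"
    and T_scale: "\<And>u c. u \<in> S \<Longrightarrow> T (c *\<^sub>R u) = c *\<^sub>R T u"
    and bounded: "\<And>u. u \<in> S \<Longrightarrow> snorm (T u) \<le> C * snorm u"
    and coercive: "\<And>u. u \<in> S \<Longrightarrow> c * ip u u \<le> ip (T u) u" and c: "c > 0"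
    and f: "f \<in> L"
  obtains u where "u \<in> S" "\<And>v. v \<in> S \<Longrightarrow> ip (T u) v = ip f v"
proof -
  have SL: "y \<in> L" if "y \<in> S" for y using that S by auto
  note S_closed [simp] = subspace_add[OF S(1)] subspace_diff[OF S(1)] subspace_scale[OF S(1)]
  have T_diff: "T (u - v) = T u - T v" if "u \<in> S" "v \<in> S" for u v
    using T_add[of "u - v" v] that by (simp add: S_closed)
  define S' where "S' = {w \<in> S. \<exists>u\<in>S. \<forall>v\<in>S. ip (T u) v = ip w v}"
  have S'S: "S' \<subseteq> S" unfolding S'_def by auto
  have S'_sub: "subspace S'"
  proof (rule subspaceI)
    show "0 \<in> S'"
      unfolding S'_def using subspace_0[OF S(1)] T_scale[of 0 0] by force
    show "x + y \<in> S'" if "x \<in> S'" "y \<in> S'" for x y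
    proof -
      obtain a b where ab: "a \<in> S" "b \<in> S" "\<forall>v\<in>S. ip (T a) v = ip x v" "\<forall>v\<in>S. ip (T b) v = ip y v"
        using \<open>x \<in> S'\<close> \<open>y \<in> S'\<close> unfolding S'_def by blast
      have xy: "x \<in> S" "y \<in> S" using that S'S by auto
      have "\<forall>v\<in>S. ip (T (a + b)) v = ip (x + y) v"
        using ab xy SL TL by (simp add: T_add ip_add)
      then show ?thesis using S_closed(1)[OF xy] S_closed(1)[OF ab(1,2)] unfolding S'_def by blast
    qed
    show "r *\<^sub>R x \<in> S'" if "x \<in> S'" for r x
    proof -
      obtain a where a: "a \<in> S" "\<forall>v\<in>S. ip (T a) v = ip x v"
        using \<open>x \<in> S'\<close> unfolding S'_def by blast
      have x: "x \<in> S" using that S'S by auto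
      have "\<forall>v\<in>S. ip (T (r *\<^sub>R a)) v = ip (r *\<^sub>R x) v"
        using a x SL TL by (simp add: T_scale ip_simps)
      then show ?thesis using S_closed(3)[OF x] S_closed(3)[OF a(1)] unfolding S'_def by blast
    qed
  qed
  have "scomplete S'"
    unfolding scomplete_def
  proof (intro allI impI)
    fix w assume w: "\<forall>n. w n \<in> S'" and wC: "sCauchy w"
    have wS: "w n \<in> S" for n using w S'S by auto
    obtain u where u: "\<And>n. u n \<in> S" "\<And>n v. v \<in> S \<Longrightarrow> ip (T (u n)) v = ip (w n) v"
    proof -
      have "\<forall>n. \<exists>u. u \<in> S \<and> (\<forall>v\<in>S. ip (T u) v = ip (w n) v)"
        using w unfolding S'_def by blast
      from choice[OF this] show ?thesis using that by blast
    qed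
    \<comment> \<open>Coercivity: preimages of a Cauchy sequence in S' form a Cauchy sequence.\<close>
    have est: "c * snorm (u m - u n) \<le> snorm (w m - w n)" for m n
    proof (cases "snorm (u m - u n) = 0")
      case True
      then show ?thesis using snorm_nonneg[of "w m - w n"] wS SL by simp
    next
      case False
      let ?d = "u m - u n"
      have dS: "?d \<in> S" using u by simp
      have "c * (snorm ?d * snorm ?d) = c * ip ?d ?d"
        using snorm_square[OF SL[OF dS]] by (simp add: power2_eq_square)
      also have "\<dots> \<le> ip (T ?d) ?d" by (rule coercive[OF dS])
      also have "\<dots> = ip (T (u m)) ?d - ip (T (u n)) ?d"
        using TL u SL[OF dS] by (simp add: T_diff ip_diff)
      also have "\<dots> = ip (w m - w n) ?d"
        using u(2)[OF dS] wS SL dS by (simp add: ip_diff)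
      also have "\<dots> \<le> snorm (w m - w n) * snorm ?d"
        using Cauchy_Schwarz[of "w m - w n" ?d] SL[OF dS] SL[OF wS] by simp
      finally have "c * snorm ?d * snorm ?d \<le> snorm (w m - w n) * snorm ?d" by simp
      moreover have "snorm ?d > 0" using False snorm_nonneg[OF SL[OF dS]] by simp
      ultimately show ?thesis by simp
    qed
    have "sCauchy u"
      unfolding sCauchy_def
    proof (intro allI impI)
      fix e :: real assume "e > 0"
      then have "c * e > 0" using c by simp
      then obtain N where N: "\<And>m n. m \<ge> N \<Longrightarrow> n \<ge> N \<Longrightarrow> snorm (w m - w n) < c * e"
        using wC unfolding sCauchy_def by blast
      have "snorm (u m - u n) < e" if "m \<ge> N" "n \<ge> N" for m n
      proof -
        have "c * snorm (u m - u n) < c * e" using est[of m n] N[OF that] by simp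
        then show ?thesis using c by simp
      qed
      then show "\<exists>N. \<forall>m\<ge>N. \<forall>n\<ge>N. snorm (u m - u n) < e" by blast
    qed
    then obtain u0 where u0: "u0 \<in> S" "stends u u0"
      using S(3) u(1) unfolding scomplete_def by blast
    obtain w0 where w0: "w0 \<in> S" "stends w w0"
      using S(3) wS wC unfolding scomplete_def by blast
    have Tu: "stends (\<lambda>n. T (u n)) (T u0)"
      unfolding stends_def
    proof (rule Lim_null_comparison)
      show "\<forall>\<^sub>F n in sequentially. norm (snorm (T (u n) - T u0)) \<le> C * snorm (u n - u0)"
      proof (intro always_eventually allI)
        fix n
        have d: "u n - u0 \<in> S" using u(1) u0(1) by simp
        have "T (u n) - T u0 = T (u n - u0)" using u(1) u0(1) by (simp add: T_diff)
        then show "norm (snorm (T (u n) - T u0)) \<le> C * snorm (u n - u0)"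
          using bounded[OF d] snorm_nonneg[OF TL[OF d]] by simp
      qed
      show "(\<lambda>n. C * snorm (u n - u0)) \<longlonglongrightarrow> 0"
        using u0(2) unfolding stends_def by (rule tendsto_mult_right_zero)
    qed
    have "ip (T u0) v = ip w0 v" if v: "v \<in> S" for v
    proof (rule LIMSEQ_unique)
      show "(\<lambda>n. ip (T (u n)) v) \<longlonglongrightarrow> ip (T u0) v"
        using TL u(1) u0(1) SL[OF v] Tu by (intro ip_tendsto) auto
      show "(\<lambda>n. ip (T (u n)) v) \<longlonglongrightarrow> ip w0 v"
        using ip_tendsto[OF SL[OF wS] SL[OF w0(1)] SL[OF v] w0(2)] u(2)[OF v] by simp
    qed
    then have "w0 \<in> S'" unfolding S'_def using u0 w0 by blast
    then show "\<exists>x\<in>S'. stends w x" using w0 by blast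
  qed
  with S'_sub S'S S(2) obtain w where w: "w \<in> S'" "\<And>v. v \<in> S' \<Longrightarrow> ip (f - w) v = 0"
    using orthogonal_projection_exists[of S' f] f by (metis subset_trans)
  have wL: "w \<in> L" using w S'S SL by blast
  obtain z where z: "z \<in> S" "\<And>v. v \<in> S \<Longrightarrow> ip (f - w - z) v = 0"
    using orthogonal_projection_exists[OF S, of "f - w"] f wL by auto
  obtain y where y: "y \<in> S" "\<And>v. v \<in> S \<Longrightarrow> ip (T z - y) v = 0"
    using orthogonal_projection_exists[OF S, of "T z"] TL z(1) by auto
  have zL: "z \<in> L" "y \<in> L" "T z \<in> L" using z(1) y(1) SL TL by auto
  have fz: "ip (f - w) v = ip z v" if "v \<in> S" for v
    using z(2)[OF that] that f wL zL SL by (simp add: ip_simps)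
  have yz: "ip (T z) v = ip y v" if "v \<in> S" for v
    using y(2)[OF that] that zL SL by (simp add: ip_simps)
  have "y \<in> S'" unfolding S'_def using y(1) z(1) yz by blast
  have "c * ip z z \<le> ip (T z) z" by (rule coercive[OF z(1)])
  also have "\<dots> = ip y z" by (rule yz[OF z(1)])
  also have "\<dots> = ip (f - w) y" using fz[OF y(1)] zL by (simp add: ip_sym)
  also have "\<dots> = 0" by (rule w(2)[OF \<open>y \<in> S'\<close>])
  finally have "ip z z = 0" using c ip_nonneg[OF zL(1)] by (simp add: mult_le_0_iff)
  then have z0: "snorm z = 0" by (simp add: snorm_def)
  have fw: "ip (f - w) v = 0" if "v \<in> S" for v
    using fz[OF that] Cauchy_Schwarz[OF zL(1) SL[OF that]] z0 by simp
  obtain u where u: "u \<in> S" "\<forall>v\<in>S. ip (T u) v = ip w v" using w(1) unfolding S'_def by blast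
  have "ip (T u) v = ip f v" if "v \<in> S" for v
    using u(2) fw[OF that] that f wL SL by (simp add: ip_diff)
  then show ?thesis by (rule that[OF u(1)])
qed

end

section \<open>Square integrable functions with values in a Euclidean space\<close>

text \<open>
  Pointwise scalar multiplication turns function spaces into real vector spaces, so that the abstract
  results above apply to sets of functions.
\<close>

instantiation "fun" :: (type, real_vector) real_vector
begin

definition scaleR_fun :: "real \<Rightarrow> ('a \<Rightarrow> 'b) \<Rightarrow> 'a \<Rightarrow> 'b" where
  "scaleR_fun c f = (\<lambda>x. c *\<^sub>R f x)"

instance
  by standard (simp_all add: scaleR_fun_def fun_eq_iff scaleR_add_right scaleR_add_left)

end

lemma scaleR_fun_apply [simp]: "(c *\<^sub>R f) x = c *\<^sub>R f x"
  by (simp add: scaleR_fun_def)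

definition l2_space :: "'x measure \<Rightarrow> ('x \<Rightarrow> 'e::euclidean_space) set" where
  "l2_space M = {F \<in> borel_measurable M. integrable M (\<lambda>x. (norm (F x))\<^sup>2)}"

definition l2_inner :: "'x measure \<Rightarrow> ('x \<Rightarrow> 'e::euclidean_space) \<Rightarrow> ('x \<Rightarrow> 'e) \<Rightarrow> real" where
  "l2_inner M F G = (\<integral>x. F x \<bullet> G x \<partial>M)"

lemma l2_measurable [measurable_dest]: "F \<in> l2_space M \<Longrightarrow> F \<in> borel_measurable M"
  by (simp add: l2_space_def)

lemma l2_square_integrable: "F \<in> l2_space M \<Longrightarrow> integrable M (\<lambda>x. (norm (F x))\<^sup>2)"
  by (simp add: l2_space_def)

lemma l2_inner_integrable:
  assumes F: "F \<in> l2_space M" and G: "G \<in> l2_space M"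
  shows "integrable M (\<lambda>x. F x \<bullet> G x)"
proof (rule Bochner_Integration.integrable_bound)
  show "integrable M (\<lambda>x. (norm (F x))\<^sup>2 + (norm (G x))\<^sup>2)"
    using F G by (simp add: l2_square_integrable)
  show "(\<lambda>x. F x \<bullet> G x) \<in> borel_measurable M" using F G by measurable
  have "norm (F x \<bullet> G x) \<le> norm ((norm (F x))\<^sup>2 + (norm (G x))\<^sup>2)" for x
  proof -
    have "2 * (norm (F x) * norm (G x)) \<le> (norm (F x))\<^sup>2 + (norm (G x))\<^sup>2"
      using sum_squares_bound[of "norm (F x)" "norm (G x)"] by (simp add: mult.assoc)
    moreover have "0 \<le> norm (F x) * norm (G x)" by simp
    ultimately have "norm (F x) * norm (G x) \<le> (norm (F x))\<^sup>2 + (norm (G x))\<^sup>2"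
      by linarith
    then show ?thesis using Cauchy_Schwarz_ineq2[of "F x" "G x"] by simp
  qed
  then show "AE x in M. norm (F x \<bullet> G x) \<le> norm ((norm (F x))\<^sup>2 + (norm (G x))\<^sup>2)" by simp
qed

text \<open>
  Almost all membership statements below reduce to this comparison: components, products with
  bounded functions and embeddings into products are pointwise bounded by the original function.
\<close>

lemma l2_space_dominated:
  fixes F :: "'x \<Rightarrow> 'e::euclidean_space" and G :: "'x \<Rightarrow> 'f::euclidean_space"
  assumes F: "F \<in> l2_space M" and G: "G \<in> borel_measurable M"
    and le: "AE x in M. norm (G x) \<le> C * norm (F x)"
  shows "G \<in> l2_space M"
proof -
  have "integrable M (\<lambda>x. (norm (G x))\<^sup>2)"
  proof (rule Bochner_Integration.integrable_bound)
    show "integrable M (\<lambda>x. C\<^sup>2 * (norm (F x))\<^sup>2)"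
      using F by (simp add: l2_square_integrable)
    show "(\<lambda>x. (norm (G x))\<^sup>2) \<in> borel_measurable M" using G by measurable
    show "AE x in M. norm ((norm (G x))\<^sup>2) \<le> norm (C\<^sup>2 * (norm (F x))\<^sup>2)"
      using le
    proof eventually_elim
      case (elim x)
      then have "(norm (G x))\<^sup>2 \<le> (C * norm (F x))\<^sup>2" by (intro power_mono) auto
      then show ?case by (simp add: power_mult_distrib)
    qed
  qed
  with G show ?thesis by (simp add: l2_space_def)
qed

lemma l2_space_add:
  assumes F: "F \<in> l2_space M" and G: "G \<in> l2_space M"
  shows "(\<lambda>x. F x + G x) \<in> l2_space M"
proof -
  have "integrable M (\<lambda>x. (norm (F x + G x))\<^sup>2)"
    using F G
    by (simp add: power2_norm_eq_inner inner_add_left inner_add_right l2_inner_integrable)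
  moreover have "(\<lambda>x. F x + G x) \<in> borel_measurable M" using F G by measurable
  ultimately show ?thesis by (simp add: l2_space_def)
qed

lemma l2_space_scaleR:
  assumes F: "F \<in> l2_space M"
  shows "(\<lambda>x. c *\<^sub>R F x) \<in> l2_space M"
proof (rule l2_space_dominated[OF F])
  show "(\<lambda>x. c *\<^sub>R F x) \<in> borel_measurable M" using F by measurable
qed (auto intro!: AE_I2)

lemma l2_space_sum:
  assumes "\<And>i. i \<in> I \<Longrightarrow> F i \<in> l2_space M"
  shows "(\<lambda>x. \<Sum>i\<in>I. F i x) \<in> l2_space M"
  using assms
proof (induction I rule: infinite_finite_induct)
  case (insert i I)
  then show ?case using l2_space_add[of "F i" M "\<lambda>x. \<Sum>i\<in>I. F i x"] by simp
qed (simp_all add: l2_space_def)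

lemma subspace_l2_space: "subspace (l2_space M)"
proof (rule subspaceI)
  show "(0::'a \<Rightarrow> 'b) \<in> l2_space M" by (simp add: l2_space_def zero_fun_def)
  show "F + G \<in> l2_space M" if "F \<in> l2_space M" "G \<in> l2_space M" for F G :: "'a \<Rightarrow> 'b"
    using l2_space_add[OF that] by (simp add: plus_fun_def)
  show "c *\<^sub>R F \<in> l2_space M" if "F \<in> l2_space M" for c and F :: "'a \<Rightarrow> 'b"
    using l2_space_scaleR[OF that] by (simp add: scaleR_fun_def)
qed

interpretation l2: semi_inner_space "l2_space M :: ('x \<Rightarrow> 'e::euclidean_space) set" "l2_inner M"
  for M :: "'x measure"
proof
  show "l2_inner M (F + G) H = l2_inner M F H + l2_inner M G H"
    if "F \<in> l2_space M" "G \<in> l2_space M" "H \<in> l2_space M" for F G H :: "'x \<Rightarrow> 'e"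
    using that by (simp add: l2_inner_def inner_add_left l2_inner_integrable)
qed (simp_all add: subspace_l2_space l2_inner_def inner_commute)

abbreviation l2_norm :: "'x measure \<Rightarrow> ('x \<Rightarrow> 'e::euclidean_space) \<Rightarrow> real" where
  "l2_norm M \<equiv> semi_inner_space.snorm (l2_inner M)"

lemma l2_norm_eq: "l2_norm M F = sqrt (\<integral>x. (norm (F x))\<^sup>2 \<partial>M)"
  by (simp add: l2.snorm_def l2_inner_def power2_norm_eq_inner)

lemma l2_norm_dominated:
  fixes F :: "'x \<Rightarrow> 'e::euclidean_space" and G :: "'x \<Rightarrow> 'f::euclidean_space"
  assumes F: "F \<in> l2_space M" and G: "G \<in> borel_measurable M" and C: "0 \<le> C"
    and le: "AE x in M. norm (G x) \<le> C * norm (F x)"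
  shows "l2_norm M G \<le> C * l2_norm M F"
proof -
  have "(\<integral>x. (norm (G x))\<^sup>2 \<partial>M) \<le> (\<integral>x. C\<^sup>2 * (norm (F x))\<^sup>2 \<partial>M)"
  proof (rule integral_mono_AE)
    show "integrable M (\<lambda>x. (norm (G x))\<^sup>2)"
      using l2_space_dominated[OF F G le] by (rule l2_square_integrable)
    show "integrable M (\<lambda>x. C\<^sup>2 * (norm (F x))\<^sup>2)"
      using F by (simp add: l2_square_integrable)
    show "AE x in M. (norm (G x))\<^sup>2 \<le> C\<^sup>2 * (norm (F x))\<^sup>2"
      using le
    proof eventually_elim
      case (elim x)
      then have "(norm (G x))\<^sup>2 \<le> (C * norm (F x))\<^sup>2" by (intro power_mono) auto
      then show ?case by (simp add: power_mult_distrib)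
    qed
  qed
  also have "\<dots> = C\<^sup>2 * (\<integral>x. (norm (F x))\<^sup>2 \<partial>M)" by simp
  finally have "l2_norm M G \<le> sqrt (C\<^sup>2 * (\<integral>x. (norm (F x))\<^sup>2 \<partial>M))"
    unfolding l2_norm_eq by (rule real_sqrt_le_mono)
  then show ?thesis using C by (simp add: l2_norm_eq real_sqrt_mult)
qed

lemma l2_norm_eq_0_AE:
  assumes F: "F \<in> l2_space M" and "l2_norm M F = 0"
  shows "AE x in M. F x = 0"
proof -
  have "(\<integral>x. (norm (F x))\<^sup>2 \<partial>M) = 0" using assms by (simp add: l2_norm_eq)
  then show ?thesis
    using integral_nonneg_eq_0_iff_AE[OF l2_square_integrable[OF F]] by simp
qed

lemma nn_integral_norm_square:
  assumes "F \<in> l2_space M"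
  shows "(\<integral>\<^sup>+x. ennreal ((norm (F x))\<^sup>2) \<partial>M) = ennreal ((l2_norm M F)\<^sup>2)"
proof -
  have "0 \<le> (\<integral>x. (norm (F x))\<^sup>2 \<partial>M)" by simp
  then show ?thesis
    using nn_integral_eq_integral[OF l2_square_integrable[OF assms]] by (simp add: l2_norm_eq)
qed

text \<open>
  The Riesz-Fischer theorem. Choose a subsequence \<open>s (r k)\<close> whose increments \<open>d k\<close> have norm at most
  \<open>2^-k\<close>. Then \<open>\<Sum>k. 2^k |d k|^2\<close> has finite integral, hence is finite almost everywhere, and
  \<open>|d k| \<le> 2^-k + 2^k |d k|^2\<close> shows that the increments are absolutely summable there. The pointwise
  limit is the limit in norm by Fatou's lemma. The weighted sum of squares makes the argument
  work on measure spaces of infinite measure, where the norm of \<open>L1\<close> is not controlled.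
\<close>

theorem scomplete_l2_space:
  "l2.scomplete M (l2_space M :: ('x \<Rightarrow> 'e::euclidean_space) set)"
  unfolding l2.scomplete_def
proof (intro allI impI)
  fix s :: "nat \<Rightarrow> 'x \<Rightarrow> 'e"
  assume "\<forall>n. s n \<in> l2_space M" and Cs: "l2.sCauchy M s"
  then have s: "s n \<in> l2_space M" for n by blast
  have [measurable]: "s n \<in> borel_measurable M" for n using s by (rule l2_measurable)
  have "\<forall>k. \<exists>N. \<forall>m\<ge>N. \<forall>n\<ge>N. l2_norm M (s m - s n) < (1/2)^k"
    using Cs unfolding l2.sCauchy_def by simp
  then obtain N where N: "\<And>k m n. \<lbrakk>m \<ge> N k; n \<ge> N k\<rbrakk> \<Longrightarrow> l2_norm M (s m - s n) < (1/2)^k"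
    by metis
  define r where "r k = (\<Sum>j\<le>k. N j)" for k
  have rN: "r j \<ge> N k" if "k \<le> j" for j k
    unfolding r_def using that member_le_sum[of k "{..j}" N] by simp
  have sq: "(l2_norm M (s m - s n))\<^sup>2 \<le> (1/4)^k" if "m \<ge> N k" "n \<ge> N k" for k m n
  proof -
    have "(l2_norm M (s m - s n))\<^sup>2 \<le> ((1/2)^k)\<^sup>2"
      using N[OF that] l2.snorm_nonneg[of "s m - s n" M] s by (intro power_mono) auto
    also have "((1/2)^k)\<^sup>2 = (1/4::real)^k"
      by (simp add: power2_eq_square flip: power_mult_distrib)
    finally show ?thesis .
  qed
  define d where "d k x = s (r (Suc k)) x - s (r k) x" for k x
  have [measurable]: "d k \<in> borel_measurable M" for k
    unfolding d_def by measurable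
  have dL: "d k = s (r (Suc k)) - s (r k)" for k by (simp add: d_def fun_eq_iff)
  have "(\<integral>\<^sup>+x. (\<Sum>k. ennreal (2^k * (norm (d k x))\<^sup>2)) \<partial>M)
      = (\<Sum>k. \<integral>\<^sup>+x. ennreal (2^k * (norm (d k x))\<^sup>2) \<partial>M)"
    by (rule nn_integral_suminf) measurable
  also have "\<dots> \<le> (\<Sum>k. ennreal ((1/2)^k))"
  proof (rule suminf_le)
    fix k
    have "(\<integral>\<^sup>+x. ennreal (2^k * (norm (d k x))\<^sup>2) \<partial>M)
        = ennreal (2^k) * (\<integral>\<^sup>+x. ennreal ((norm (d k x))\<^sup>2) \<partial>M)"
      by (subst nn_integral_cmult[symmetric]) (auto simp: ennreal_mult)
    also have "\<dots> = ennreal (2^k) * ennreal ((l2_norm M (d k))\<^sup>2)"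
      unfolding dL using s by (subst nn_integral_norm_square) auto
    also have "\<dots> = ennreal (2^k * (l2_norm M (d k))\<^sup>2)"
      by (simp add: ennreal_mult)
    also have "\<dots> \<le> ennreal ((1/2)^k)"
    proof (rule ennreal_leI)
      have "2^k * (l2_norm M (d k))\<^sup>2 \<le> 2^k * (1/4)^k"
        unfolding dL using sq[of k "r (Suc k)" "r k"] rN by (intro mult_left_mono) auto
      then show "2^k * (l2_norm M (d k))\<^sup>2 \<le> (1/2)^k"
        by (simp flip: power_mult_distrib)
    qed
    finally show "(\<integral>\<^sup>+x. ennreal (2^k * (norm (d k x))\<^sup>2) \<partial>M) \<le> ennreal ((1/2)^k)" .
  qed auto
  also have "\<dots> < \<infinity>"
    by (subst suminf_ennreal2) (auto simp: summable_geometric)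
  finally have "AE x in M. (\<Sum>k. ennreal (2^k * (norm (d k x))\<^sup>2)) \<noteq> \<infinity>"
    by (intro nn_integral_PInf_AE) auto
  then have conv: "AE x in M. (\<lambda>k. s (r k) x) \<longlonglongrightarrow> lim (\<lambda>k. s (r k) x)"
  proof eventually_elim
    case (elim x)
    have "summable (\<lambda>k. 2^k * (norm (d k x))\<^sup>2)"
      using elim by (intro summable_suminf_not_top) auto
    then have sm: "summable (\<lambda>k. (1/2)^k + 2^k * (norm (d k x))\<^sup>2)"
      by (intro summable_add summable_geometric) auto
    have "summable (\<lambda>k. norm (d k x))"
    proof (rule summable_comparison_test'[OF sm])
      fix k :: nat
      define a :: real where "a = 2^k"
      have a: "a > 0" "(1/2)^k = 1 / a" by (simp_all add: a_def power_one_over)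
      \<comment> \<open>The inequality of arithmetic and geometric means for 1 and a |d k x|.\<close>
      have "2 * a * norm (d k x) \<le> 1 + (a * norm (d k x))\<^sup>2"
        using sum_squares_bound[of 1 "a * norm (d k x)"] by simp
      moreover have "0 \<le> a * norm (d k x)" using a by simp
      ultimately have "a * norm (d k x) \<le> 1 + (a * norm (d k x))\<^sup>2" by linarith
      then have "norm (d k x) \<le> 1 / a + a * (norm (d k x))\<^sup>2"
        using a by (simp add: field_simps power2_eq_square)
      then show "norm (norm (d k x)) \<le> (1/2)^k + 2^k * (norm (d k x))\<^sup>2"
        using a by (simp add: a_def)
    qed
    then have "summable (\<lambda>k. d k x)" by (rule summable_norm_cancel)
    then have "convergent (\<lambda>n. s (r 0) x + (\<Sum>k<n. d k x))"
      unfolding summable_iff_convergent by (intro convergent_add convergent_const)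
    moreover have "s (r 0) x + (\<Sum>k<n. d k x) = s (r n) x" for n
      by (simp add: d_def sum_lessThan_telescope[of "\<lambda>k. s (r k) x"])
    ultimately show ?case by (simp add: convergent_LIMSEQ_iff)
  qed
  define f where "f x = lim (\<lambda>k. s (r k) x)" for x
  have fm [measurable]: "f \<in> borel_measurable M" unfolding f_def by measurable
  have est: "(\<integral>\<^sup>+x. ennreal ((norm (s n x - f x))\<^sup>2) \<partial>M) \<le> ennreal ((1/4)^k)"
    if n: "n \<ge> N k" for n k
  proof -
    have "(\<integral>\<^sup>+x. ennreal ((norm (s n x - f x))\<^sup>2) \<partial>M)
        = (\<integral>\<^sup>+x. liminf (\<lambda>j. ennreal ((norm (s n x - s (r j) x))\<^sup>2)) \<partial>M)"
    proof (rule nn_integral_cong_AE)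
      show "AE x in M. ennreal ((norm (s n x - f x))\<^sup>2)
          = liminf (\<lambda>j. ennreal ((norm (s n x - s (r j) x))\<^sup>2))"
        using conv
      proof eventually_elim
        case (elim x)
        then have "(\<lambda>j. ennreal ((norm (s n x - s (r j) x))\<^sup>2))
            \<longlonglongrightarrow> ennreal ((norm (s n x - f x))\<^sup>2)"
          unfolding f_def by (intro tendsto_intros)
        then show ?case by (rule lim_imp_Liminf[OF sequentially_bot, symmetric])
      qed
    qed
    also have "\<dots> \<le> liminf (\<lambda>j. \<integral>\<^sup>+x. ennreal ((norm (s n x - s (r j) x))\<^sup>2) \<partial>M)"
      by (rule nn_integral_liminf) measurable
    also have "\<dots> \<le> limsup (\<lambda>j. \<integral>\<^sup>+x. ennreal ((norm (s n x - s (r j) x))\<^sup>2) \<partial>M)"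
      by (rule Liminf_le_Limsup) simp
    also have "\<dots> \<le> ennreal ((1/4)^k)"
    proof (rule Limsup_bounded)
      have "(\<integral>\<^sup>+x. ennreal ((norm (s n x - s (r j) x))\<^sup>2) \<partial>M) \<le> ennreal ((1/4)^k)"
        if j: "j \<ge> k" for j
      proof -
        have "(\<integral>\<^sup>+x. ennreal ((norm (s n x - s (r j) x))\<^sup>2) \<partial>M)
            = ennreal ((l2_norm M (s n - s (r j)))\<^sup>2)"
          using nn_integral_norm_square[of "s n - s (r j)" M] s by simp
        also have "\<dots> \<le> ennreal ((1/4)^k)"
          using sq[OF n rN[OF j]] by (rule ennreal_leI)
        finally show ?thesis .
      qed
      then show "\<forall>\<^sub>F j in sequentially.
          (\<integral>\<^sup>+x. ennreal ((norm (s n x - s (r j) x))\<^sup>2) \<partial>M) \<le> ennreal ((1/4)^k)"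
        unfolding eventually_sequentially by blast
    qed
    finally show ?thesis .
  qed
  have dif: "s n - f \<in> l2_space M" if "n \<ge> N k" for n k
  proof -
    have "integrable M (\<lambda>x. (norm (s n x - f x))\<^sup>2)"
      using order_le_less_trans[OF est[OF that] ennreal_less_top]
      by (intro integrableI_bounded) auto
    then show ?thesis
      by (simp add: l2_space_def fun_diff_def)
  qed
  have fL: "f \<in> l2_space M"
  proof -
    have "f = s (N 0) - (s (N 0) - f)" by simp
    then show ?thesis using dif[of 0 "N 0"] s by (metis l2.L_closed(3) le_refl)
  qed
  have nrm: "l2_norm M (s n - f) \<le> (1/2)^k" if n: "n \<ge> N k" for n k
  proof -
    have "ennreal ((l2_norm M (s n - f))\<^sup>2) \<le> ennreal ((1/4)^k)"
      using est[OF n] nn_integral_norm_square[OF dif[OF n]] by simp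
    then have "(l2_norm M (s n - f))\<^sup>2 \<le> (1/4)^k" by (simp add: ennreal_le_iff)
    also have "(1/4)^k = ((1/2::real)^k)\<^sup>2"
      by (simp add: power2_eq_square flip: power_mult_distrib)
    finally show ?thesis by (rule power2_le_imp_le) simp
  qed
  have "l2.stends M s f"
    unfolding l2.stends_def LIMSEQ_iff
  proof (intro allI impI)
    fix e :: real assume "e > 0"
    then obtain k where k: "(1/2)^k < e" using real_arch_pow_inv[of e "1/2"] by auto
    have "norm (l2_norm M (s n - f) - 0) < e" if "n \<ge> N k" for n
      using nrm[OF that] k l2.snorm_nonneg[OF dif[OF that]] by simp
    then show "\<exists>no. \<forall>n\<ge>no. norm (l2_norm M (s n - f) - 0) < e" by blast
  qed
  with fL show "\<exists>x\<in>l2_space M. l2.stends M s x" by blast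
qed

section \<open>Test functions, integration by parts and the fundamental lemma\<close>

lemma partial_eqI: "(f has_derivative D) (at x) \<Longrightarrow> partial i f x = D (axis i 1)"
  unfolding partial_def by (metis frechet_derivative_at)

lemma has_derivative_frechet:
  "f differentiable (at x) \<Longrightarrow> (f has_derivative frechet_derivative f (at x)) (at x)"
  by (simp add: frechet_derivative_works)

lemma partial_const: "partial i (\<lambda>x. c) = (\<lambda>x. 0)"
  by (rule ext, rule partial_eqI) (rule has_derivative_const)

lemma partial_add:
  assumes "\<forall>x. f differentiable (at x)" "\<forall>x. g differentiable (at x)"
  shows "partial i (\<lambda>x. f x + g x) = (\<lambda>x. partial i f x + partial i g x)"
proof
  fix x
  show "partial i (\<lambda>x. f x + g x) x = partial i f x + partial i g x"
    using partial_eqI[OF has_derivative_add[OF has_derivative_frechet has_derivative_frechet]]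
      assms unfolding partial_def by blast
qed

lemma partial_mult:
  assumes "\<forall>x. f differentiable (at x)" "\<forall>x. g differentiable (at x)"
  shows "partial i (\<lambda>x. f x * g x) = (\<lambda>x. f x * partial i g x + partial i f x * g x)"
proof
  fix x
  show "partial i (\<lambda>x. f x * g x) x = f x * partial i g x + partial i f x * g x"
    using partial_eqI[OF has_derivative_mult[OF has_derivative_frechet has_derivative_frechet]]
      assms unfolding partial_def by blast
qed

lemma Ck_continuous: "Ck k f \<Longrightarrow> continuous_on UNIV f"
  by (cases k) (auto intro!: continuous_at_imp_continuous_on differentiable_imp_continuous_within)

lemma Ck_Suc_imp_Ck: "Ck (Suc k) f \<Longrightarrow> Ck k f"
proof (induction k arbitrary: f)
  case 0
  then show ?case using Ck_continuous[of "Suc 0" f] by simp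
next
  case (Suc k)
  from Suc.prems have "\<forall>x. f differentiable (at x)" "\<And>i. Ck (Suc k) (partial i f)"
    unfolding Ck.simps(2)[of "Suc k" f] by blast+
  then show ?case unfolding Ck.simps(2)[of k f] using Suc.IH by blast
qed

lemma Ck_const: "Ck k (\<lambda>x. c)"
  by (induction k arbitrary: c) (simp_all add: partial_const)

lemma Ck_add: "Ck k f \<Longrightarrow> Ck k g \<Longrightarrow> Ck k (\<lambda>x. f x + g x)"
  by (induction k arbitrary: f g) (auto intro: continuous_on_add simp: partial_add)

lemma Ck_mult: "Ck k f \<Longrightarrow> Ck k g \<Longrightarrow> Ck k (\<lambda>x. f x * g x)"
proof (induction k arbitrary: f g)
  case 0
  then show ?case by (auto intro: continuous_on_mult)
next
  case (Suc k)
  have "Ck k f" "Ck k g" using Suc.prems Ck_Suc_imp_Ck by blast+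
  with Suc show ?case by (simp add: partial_mult Ck_add)
qed

lemma Ck_prod:
  assumes "\<And>i. i \<in> I \<Longrightarrow> Ck k (f i)"
  shows "Ck k (\<lambda>x. \<Prod>i\<in>I. f i x)"
  using assms
  by (induction I rule: infinite_finite_induct) (simp_all add: Ck_const Ck_mult)

text \<open>
  The functions \<open>exp (-1/t) / t^m\<close>, extended by zero, are closed under differentiation up to linear
  combinations (\<open>flat_has_derivative\<close>). An induction over all \<open>m\<close> at once therefore gives smoothness of
  \<open>exp (-1/t)\<close> without describing its higher derivatives.
\<close>

definition flat :: "nat \<Rightarrow> real \<Rightarrow> real" where
  "flat m t = (if t > 0 then exp (- (1 / t)) / t ^ m else 0)"

text \<open>
  All orders of vanishing at zero come from a single term of the exponential series, namely
  \<open>(1/t)^(m+k) / (m+k)! \<le> exp (1/t)\<close>.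
\<close>

lemma flat_le: "\<bar>flat m t\<bar> \<le> fact (m + k) * \<bar>t\<bar> ^ k"
proof (cases "t > 0")
  case True
  have pos: "(1 / t) ^ (m + k) / fact (m + k) > 0" using True by simp
  have "(1 / t) ^ (m + k) / fact (m + k) \<le> exp (1 / t)"
  proof -
    have sm: "(\<lambda>n. (1 / t) ^ n / fact n) sums exp (1 / t)"
      using exp_converges[of "1 / t"] by (simp add: divide_inverse mult.commute)
    have "(\<Sum>n\<in>{m + k}. (1 / t) ^ n / fact n) \<le> exp (1 / t)"
      unfolding sums_unique[OF sm] using True
      by (intro sum_le_suminf sums_summable[OF sm]) auto
    then show ?thesis by simp
  qed
  then have "1 / exp (1 / t) \<le> 1 / ((1 / t) ^ (m + k) / fact (m + k))"
    using pos by (intro divide_left_mono mult_pos_pos) auto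
  then have "exp (- (1 / t)) \<le> fact (m + k) * t ^ (m + k)"
    by (simp add: exp_minus divide_inverse power_inverse mult.commute)
  then show ?thesis
    using True by (simp add: flat_def divide_le_eq power_add mult_ac)
next
  case False
  then show ?thesis by (simp add: flat_def)
qed

lemma flat_has_derivative:
  "(flat m has_real_derivative (flat (m + 2) t - real m * flat (m + 1) t)) (at t)"
proof -
  consider "t > 0" | "t < 0" | "t = 0" by linarith
  then show ?thesis
  proof cases
    case 1
    have "((\<lambda>t. exp (- (1 / t)) / t ^ m) has_real_derivative
        (flat (m + 2) t - real m * flat (m + 1) t)) (at t)"
    proof (rule DERIV_cong)
      have "((\<lambda>t. exp (- (1 / t))) has_real_derivative exp (- (1 / t)) / t\<^sup>2) (at t)"
        using 1 by (auto intro!: derivative_eq_intros simp: power2_eq_square)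
      moreover have "((\<lambda>t. t ^ m) has_real_derivative real m * t ^ (m - 1)) (at t)"
        using DERIV_pow[of m t] by simp
      ultimately show "((\<lambda>t. exp (- (1 / t)) / t ^ m) has_real_derivative
          (exp (- (1 / t)) / t\<^sup>2 * t ^ m - exp (- (1 / t)) * (real m * t ^ (m - 1)))
            / (t ^ m * t ^ m)) (at t)"
        using 1 by (intro DERIV_divide) auto
      show "(exp (- (1 / t)) / t\<^sup>2 * t ^ m - exp (- (1 / t)) * (real m * t ^ (m - 1)))
            / (t ^ m * t ^ m) = flat (m + 2) t - real m * flat (m + 1) t"
        using 1 by (cases m) (simp_all add: flat_def field_simps power2_eq_square)
    qed
    then show ?thesis
    proof (rule has_field_derivative_transform_within_open)
      show "open {0::real<..}" "t \<in> {0<..}" using 1 by auto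
    qed (auto simp: flat_def)
  next
    case 2
    have "((\<lambda>t. 0) has_real_derivative 0) (at t)" by simp
    then have "(flat m has_real_derivative 0) (at t)"
    proof (rule has_field_derivative_transform_within_open)
      show "open {..<0::real}" "t \<in> {..<0}" using 2 by auto
    qed (auto simp: flat_def)
    then show ?thesis using 2 by (simp add: flat_def)
  next
    case 3
    \<comment> \<open>At zero, quadratic vanishing makes the difference quotient tend to zero.\<close>
    have "((\<lambda>y. (flat m y - flat m 0) / (y - 0)) \<longlongrightarrow> 0) (at 0)"
    proof (rule Lim_null_comparison)
      show "\<forall>\<^sub>F y in at 0. norm ((flat m y - flat m 0) / (y - 0)) \<le> fact (m + 2) * \<bar>y\<bar>"
      proof (rule eventually_at_filter[THEN iffD2, OF always_eventually], intro allI impI)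
        fix y :: real assume "y \<noteq> 0"
        then show "norm ((flat m y - flat m 0) / (y - 0)) \<le> fact (m + 2) * \<bar>y\<bar>"
          using flat_le[of m y 2]
          by (simp add: flat_def[of m 0] divide_le_eq power2_eq_square mult.assoc)
      qed
      show "((\<lambda>y. fact (m + 2) * \<bar>y\<bar>) \<longlongrightarrow> (0::real)) (at 0)"
        by (intro tendsto_eq_intros) auto
    qed
    then show ?thesis
      using 3 by (simp add: has_field_derivative_iff flat_def[of _ 0])
  qed
qed

lemma Ck_flat_coordinate: "Ck k (\<lambda>x. flat m (c * (x $ i - a)))"
proof (induction k arbitrary: m)
  case 0
  have "continuous_on UNIV (flat m)"
    using flat_has_derivative by (auto intro!: continuous_at_imp_continuous_on DERIV_isCont)
  then show ?case
    by (auto intro!: continuous_on_compose2[of UNIV "flat m"] continuous_intros)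
next
  case (Suc k)
  let ?l = "\<lambda>x. c * (x $ i - a)"
  have d: "((\<lambda>x. flat m (?l x)) has_derivative
      (\<lambda>v. (c * v $ i) * (flat (m + 2) (?l x) - real m * flat (m + 1) (?l x)))) (at x)" for x
    by (rule DERIV_compose_FDERIV[OF flat_has_derivative])
      (auto intro!: derivative_eq_intros bounded_linear_imp_has_derivative bounded_linear_vec_nth)
  have p: "partial j (\<lambda>x. flat m (?l x)) = (\<lambda>x. (c * (axis j 1 :: real^'a) $ i) *
      (flat (m + 2) (?l x) + (- real m) * flat (m + 1) (?l x)))" for j
    using partial_eqI[OF d, of j] by (auto simp: fun_eq_iff)
  show ?case
    unfolding Ck.simps p
    using d by (intro conjI allI Ck_mult Ck_add Ck_const Suc) (auto simp: differentiable_def)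
qed

text \<open>
  Products of one-dimensional profiles that vanish off the box; as \<open>n\<close> grows they increase to the
  indicator function of the open box, because \<open>exp (-1/(n t))\<close> tends to 1 for every \<open>t > 0\<close>.
\<close>

definition box_bump :: "real^'n \<Rightarrow> real^'n \<Rightarrow> nat \<Rightarrow> real^'n \<Rightarrow> real" where
  "box_bump a b n x =
     (\<Prod>i\<in>UNIV. flat 0 (real n * (x $ i - a $ i)) * flat 0 (- real n * (x $ i - b $ i)))"

lemma flat_0_bounds: "0 \<le> flat 0 t \<and> flat 0 t \<le> 1"
  by (simp add: flat_def)

lemma box_bump_bounds: "0 \<le> box_bump a b n x \<and> box_bump a b n x \<le> 1"
  unfolding box_bump_def using flat_0_bounds
  by (intro conjI prod_nonneg prod_le_1 mult_nonneg_nonneg mult_le_one) auto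

lemma box_bump_outside:
  assumes "x \<notin> box a b"
  shows "box_bump a b n x = 0"
proof -
  obtain i where "\<not> (a $ i < x $ i \<and> x $ i < b $ i)"
    using assms by (auto simp: mem_box_cart)
  then have "flat 0 (real n * (x $ i - a $ i)) = 0 \<or> flat 0 (- real n * (x $ i - b $ i)) = 0"
    by (auto simp: flat_def zero_less_mult_iff mult_less_0_iff)
  then show ?thesis unfolding box_bump_def by (auto intro!: prod_zero)
qed

lemma flat_0_tendsto_1:
  assumes "t > 0"
  shows "(\<lambda>n. flat 0 (real n * t)) \<longlonglongrightarrow> 1"
proof -
  have "(\<lambda>n. exp (- (1 / (real n * t)))) \<longlonglongrightarrow> exp (- 0)"
    using assms by (intro tendsto_intros tendsto_divide_0[OF tendsto_const]
        filterlim_at_top_imp_at_infinity filterlim_tendsto_pos_mult_at_top[OF tendsto_const]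
        filterlim_at_top_mult_tendsto_pos[OF tendsto_const] filterlim_real_sequentially)
  then have "(\<lambda>n. exp (- (1 / (real n * t)))) \<longlonglongrightarrow> 1" by simp
  then show ?thesis
    by (rule Lim_transform_eventually)
      (use assms in \<open>auto simp: flat_def eventually_sequentially intro!: exI[of _ 1]\<close>)
qed

lemma box_bump_tendsto_indicator: "(\<lambda>n. box_bump a b n x) \<longlonglongrightarrow> indicator (box a b) x"
proof (cases "x \<in> box a b")
  case True
  then have x: "a $ i < x $ i" "x $ i < b $ i" for i by (auto simp: mem_box_cart)
  have "(\<lambda>n. box_bump a b n x) \<longlonglongrightarrow> (\<Prod>i\<in>(UNIV::'a set). 1 * 1)"
    unfolding box_bump_def
  proof (intro tendsto_prod tendsto_mult)
    fix i
    show "(\<lambda>n. flat 0 (real n * (x $ i - a $ i))) \<longlonglongrightarrow> 1"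
      using flat_0_tendsto_1[of "x $ i - a $ i"] x by simp
    show "(\<lambda>n. flat 0 (- real n * (x $ i - b $ i))) \<longlonglongrightarrow> 1"
      using flat_0_tendsto_1[of "b $ i - x $ i"] x by (simp add: algebra_simps)
  qed
  then show ?thesis using True by simp
qed (simp add: box_bump_outside)

lemma test_functionsI:
  assumes "\<And>k. Ck k \<phi>" and K: "compact K" "K \<subseteq> \<Omega>" and out: "\<And>x. x \<notin> K \<Longrightarrow> \<phi> x = 0"
  shows "\<phi> \<in> test_functions \<Omega>"
proof -
  have "closure {x. \<phi> x \<noteq> 0} \<subseteq> K"
    using out K by (intro closure_minimal compact_imp_closed) auto
  moreover from this have "compact (closure {x. \<phi> x \<noteq> 0})"
    using K(1) by (metis closed_Int_compact closed_closure inf.absorb1)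
  ultimately show ?thesis using assms by (auto simp: test_functions_def)
qed

lemma test_functionsE:
  assumes "\<phi> \<in> test_functions \<Omega>"
  obtains K where "\<forall>k. Ck k \<phi>" "compact K" "K \<subseteq> \<Omega>" "\<forall>x. x \<notin> K \<longrightarrow> \<phi> x = 0"
proof (rule that[of "closure {x. \<phi> x \<noteq> 0}"])
  show "\<forall>x. x \<notin> closure {x. \<phi> x \<noteq> 0} \<longrightarrow> \<phi> x = 0"
    using closure_subset[of "{x. \<phi> x \<noteq> 0}"] by auto
qed (use assms in \<open>auto simp: test_functions_def\<close>)

lemma test_functions_zero: "(\<lambda>x. 0) \<in> test_functions \<Omega>"
  by (rule test_functionsI[of _ "{}"]) (auto intro: Ck_const)

lemma test_functions_add:
  assumes "\<phi> \<in> test_functions \<Omega>" "\<psi> \<in> test_functions \<Omega>"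
  shows "(\<lambda>x. \<phi> x + \<psi> x) \<in> test_functions \<Omega>"
proof -
  obtain K where K: "\<forall>k. Ck k \<phi>" "compact K" "K \<subseteq> \<Omega>" "\<forall>x. x \<notin> K \<longrightarrow> \<phi> x = 0"
    by (rule test_functionsE[OF assms(1)])
  obtain L where L: "\<forall>k. Ck k \<psi>" "compact L" "L \<subseteq> \<Omega>" "\<forall>x. x \<notin> L \<longrightarrow> \<psi> x = 0"
    by (rule test_functionsE[OF assms(2)])
  show ?thesis
    using K L by (intro test_functionsI[of _ "K \<union> L"] Ck_add) auto
qed

lemma test_functions_mult:
  assumes "\<And>k. Ck k \<phi>" "\<psi> \<in> test_functions \<Omega>"
  shows "(\<lambda>x. \<phi> x * \<psi> x) \<in> test_functions \<Omega>"
proof -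
  obtain L where L: "\<forall>k. Ck k \<psi>" "compact L" "L \<subseteq> \<Omega>" "\<forall>x. x \<notin> L \<longrightarrow> \<psi> x = 0"
    by (rule test_functionsE[OF assms(2)])
  show ?thesis
    using assms(1) L by (intro test_functionsI[of _ L] Ck_mult) auto
qed

lemma box_bump_test_function:
  assumes "cbox a b \<subseteq> \<Omega>"
  shows "box_bump a b n \<in> test_functions \<Omega>"
proof (rule test_functionsI[of _ "cbox a b"])
  show "Ck k (box_bump a b n)" for k
    unfolding box_bump_def by (intro Ck_prod Ck_mult Ck_flat_coordinate)
  show "box_bump a b n x = 0" if "x \<notin> cbox a b" for x
    using that box_subset_cbox by (intro box_bump_outside) blast
qed (use assms in auto)

lemma partial_test_function:
  assumes "\<phi> \<in> test_functions \<Omega>"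
  shows "partial i \<phi> \<in> test_functions \<Omega>"
proof -
  obtain K where K: "\<forall>k. Ck k \<phi>" "compact K" "K \<subseteq> \<Omega>" "\<forall>x. x \<notin> K \<longrightarrow> \<phi> x = 0"
    by (rule test_functionsE[OF assms])
  show ?thesis
  proof (rule test_functionsI[OF _ K(2,3)])
    show "Ck k (partial i \<phi>)" for k using K(1) Ck.simps(2)[of k \<phi>] by blast
    show "partial i \<phi> x = 0" if "x \<notin> K" for x
    proof -
      have "((\<lambda>x. 0) has_derivative (\<lambda>v. 0)) (at x)" by simp
      then have "(\<phi> has_derivative (\<lambda>v. 0)) (at x)"
        by (rule has_derivative_transform_within_open[of _ _ _ _ "- K"])
          (use that K in \<open>auto simp: compact_imp_closed open_Compl\<close>)
      then show ?thesis by (simp add: partial_eqI)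
    qed
  qed
qed

lemma test_function_differentiable:
  "\<phi> \<in> test_functions \<Omega> \<Longrightarrow> \<forall>x. \<phi> differentiable (at x)"
  by (auto simp: test_functions_def dest: spec[of _ "Suc 0"])

lemma test_function_continuous:
  "\<phi> \<in> test_functions \<Omega> \<Longrightarrow> continuous_on UNIV \<phi>"
  by (auto simp: test_functions_def intro: Ck_continuous)

lemma test_function_bounded:
  assumes "\<phi> \<in> test_functions \<Omega>"
  obtains B where "B > 0" "\<forall>x. \<bar>\<phi> x\<bar> \<le> B"
proof -
  obtain K where "\<forall>k. Ck k \<phi>" and K: "compact K" and "K \<subseteq> \<Omega>"
      and out: "\<forall>x. x \<notin> K \<longrightarrow> \<phi> x = 0"
    by (rule test_functionsE[OF assms])
  have "bounded (\<phi> ` K)"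
    using K test_function_continuous[OF assms]
    by (intro compact_imp_bounded compact_continuous_image) (auto intro: continuous_on_subset)
  then obtain B where B: "B > 0" "\<And>x. x \<in> K \<Longrightarrow> \<bar>\<phi> x\<bar> \<le> B"
    by (auto simp: bounded_pos)
  show ?thesis
  proof (rule that[OF B(1)])
    show "\<forall>x. \<bar>\<phi> x\<bar> \<le> B" using B out by (metis abs_zero less_imp_le)
  qed
qed

text \<open>
  Translation invariance gives \<open>\<integral> (\<phi> (x + h e) - \<phi> x) / h = 0\<close> for every \<open>h > 0\<close>. The difference
  quotients are bounded by the supremum of the partial derivative (mean value theorem) and, for
  \<open>h \<le> 1\<close>, supported in a fixed ball, so dominated convergence applies as \<open>h\<close> tends to zero.
\<close>

lemma integral_partial_test_function:
  assumes \<Omega>: "open \<Omega>" and \<phi>: "\<phi> \<in> test_functions \<Omega>"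
  shows "(\<integral>x. partial i \<phi> x \<partial>lebesgue_on \<Omega>) = 0"
proof -
  obtain K where "\<forall>k. Ck k \<phi>" and K: "compact K" "K \<subseteq> \<Omega>" "\<forall>x. x \<notin> K \<longrightarrow> \<phi> x = 0"
    by (rule test_functionsE[OF \<phi>])
  have p\<phi>: "partial i \<phi> \<in> test_functions \<Omega>" by (rule partial_test_function[OF \<phi>])
  obtain L where "\<forall>k. Ck k (partial i \<phi>)" and "compact L"
      and L: "L \<subseteq> \<Omega>" "\<forall>x. x \<notin> L \<longrightarrow> partial i \<phi> x = 0"
    by (rule test_functionsE[OF p\<phi>])
  obtain B where B: "B > 0" "\<forall>x. \<bar>partial i \<phi> x\<bar> \<le> B"
    by (rule test_function_bounded[OF p\<phi>])
  obtain r where r: "\<And>x. x \<in> K \<Longrightarrow> norm x \<le> r"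
    using compact_imp_bounded[OF K(1)] by (auto simp: bounded_iff)
  have [measurable]: "\<phi> \<in> borel_measurable borel" "partial i \<phi> \<in> borel_measurable borel"
    using test_function_continuous \<phi> p\<phi> by (blast intro: borel_measurable_continuous_onI)+
  let ?e = "axis i 1 :: real^'a"
  define h where "h n = inverse (real (Suc n))" for n
  have h: "0 < h n" "h n \<le> 1" for n by (simp_all add: h_def field_simps)
  have deriv: "((\<lambda>t. \<phi> (x + t *\<^sub>R ?e)) has_real_derivative partial i \<phi> (x + t *\<^sub>R ?e)) (at t)"
    for x t
  proof -
    have "(\<phi> has_derivative frechet_derivative \<phi> (at (x + t *\<^sub>R ?e))) (at (x + t *\<^sub>R ?e))"
      using test_function_differentiable[OF \<phi>] by (blast intro: has_derivative_frechet)
    moreover have "((\<lambda>t. x + t *\<^sub>R ?e) has_derivative (\<lambda>s. s *\<^sub>R ?e)) (at t)"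
      by (auto intro!: derivative_eq_intros)
    ultimately have "((\<lambda>t. \<phi> (x + t *\<^sub>R ?e)) has_derivative
        (\<lambda>s. frechet_derivative \<phi> (at (x + t *\<^sub>R ?e)) (s *\<^sub>R ?e))) (at t)"
      by (rule has_derivative_compose[rotated])
    moreover have "frechet_derivative \<phi> (at y) (s *\<^sub>R ?e) = s * partial i \<phi> y" for s y
      using linear_frechet_derivative[of \<phi> "at y"] test_function_differentiable[OF \<phi>]
      by (simp add: partial_def linear_scale)
    ultimately show ?thesis
      by (simp add: has_field_derivative_def mult.commute[of _ "partial i \<phi> _"])
  qed
  define q where "q n x = (\<phi> (h n *\<^sub>R ?e + x) - \<phi> x) / h n" for n x
  have [measurable]: "q n \<in> borel_measurable borel" for n
    unfolding q_def by measurable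
  have int_\<phi>: "integrable lborel \<phi>"
  proof -
    have "integrable lborel (\<lambda>x. indicator K x *\<^sub>R \<phi> x)"
      using K(1) test_function_continuous[OF \<phi>]
      by (intro borel_integrable_compact) (auto intro: continuous_on_subset)
    moreover have "(\<lambda>x. indicator K x *\<^sub>R \<phi> x) = \<phi>"
      using K(3) by (auto simp: fun_eq_iff indicator_def)
    ultimately show ?thesis by simp
  qed
  have shift: "integrable lborel (\<lambda>x. \<phi> (t + x)) \<and> (\<integral>x. \<phi> (t + x) \<partial>lborel) = (\<integral>x. \<phi> x \<partial>lborel)" for t
  proof -
    have "integrable (distr lborel borel ((+) t)) \<phi>" using int_\<phi> by (simp add: lborel_distr_plus)
    then have "integrable lborel (\<lambda>x. \<phi> (t + x))" by (subst (asm) integrable_distr_eq) auto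
    moreover have "(\<integral>x. \<phi> x \<partial>distr lborel borel ((+) t)) = (\<integral>x. \<phi> (t + x) \<partial>lborel)"
      by (rule integral_distr) auto
    ultimately show ?thesis by (simp add: lborel_distr_plus)
  qed
  have q0: "(\<integral>x. q n x \<partial>lborel) = 0" for n
    unfolding q_def using shift[of "h n *\<^sub>R ?e"] int_\<phi> by simp
  have "(\<lambda>n. \<integral>x. q n x \<partial>lborel) \<longlonglongrightarrow> (\<integral>x. partial i \<phi> x \<partial>lborel)"
  proof (rule integral_dominated_convergence)
    show "integrable lborel (\<lambda>x. B * indicator (cball 0 (r + 1)) x :: real)"
      by (intro integrable_mult_right integrable_real_indicator)
        (use emeasure_bounded_finite[OF bounded_cball, of 0 "r + 1"] in auto)
    show "AE x in lborel. (\<lambda>n. q n x) \<longlonglongrightarrow> partial i \<phi> x"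
    proof (rule AE_I2)
      fix x
      have "((\<lambda>t. (\<phi> (x + t *\<^sub>R ?e) - \<phi> x) / t) \<longlongrightarrow> partial i \<phi> x) (at 0)"
        using deriv[of x 0] by (simp add: has_field_derivative_iff)
      moreover have "filterlim h (at 0) sequentially"
      proof -
        have "h \<longlonglongrightarrow> 0"
          unfolding h_def by (rule LIMSEQ_inverse_real_of_nat)
        then show ?thesis using h(1) by (auto simp: filterlim_at less_imp_neq[symmetric])
      qed
      ultimately have "(\<lambda>n. (\<phi> (x + h n *\<^sub>R ?e) - \<phi> x) / h n) \<longlonglongrightarrow> partial i \<phi> x"
        by (rule filterlim_compose)
      then show "(\<lambda>n. q n x) \<longlonglongrightarrow> partial i \<phi> x"
        by (simp add: q_def add.commute)
    qed
    show "AE x in lborel. norm (q n x) \<le> B * indicator (cball 0 (r + 1)) x" for n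
    proof (rule AE_I2)
      fix x
      show "norm (q n x) \<le> B * indicator (cball 0 (r + 1)) x"
      proof (cases "norm x \<le> r + 1")
        case True
        have "\<exists>z. z > 0 \<and> z < h n \<and> \<phi> (x + h n *\<^sub>R ?e) - \<phi> (x + 0 *\<^sub>R ?e)
            = (h n - 0) * partial i \<phi> (x + z *\<^sub>R ?e)"
          using h by (intro MVT2 deriv)
        then obtain z where "\<phi> (x + h n *\<^sub>R ?e) - \<phi> x = h n * partial i \<phi> (x + z *\<^sub>R ?e)"
          by auto
        then have "q n x = partial i \<phi> (x + z *\<^sub>R ?e)"
          using h(1)[of n] by (simp add: q_def add.commute)
        then show ?thesis using B True by simp
      next
        case False
        have "x \<notin> K" using r False by force
        moreover have "h n *\<^sub>R ?e + x \<notin> K"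
        proof
          assume "h n *\<^sub>R ?e + x \<in> K"
          then have "norm (h n *\<^sub>R ?e + x) \<le> r" by (rule r)
          moreover have "norm x \<le> norm (h n *\<^sub>R ?e + x) + norm (h n *\<^sub>R ?e)"
            by (metis add_diff_cancel_left' add.commute norm_triangle_ineq4)
          moreover have "norm (h n *\<^sub>R ?e) \<le> 1" using h[of n] by simp
          ultimately show False using False by linarith
        qed
        ultimately show ?thesis using K(3) False by (simp add: q_def)
      qed
    qed
  qed measurable
  then have "(\<integral>x. partial i \<phi> x \<partial>lborel) = 0"
    by (simp add: q0 LIMSEQ_const_iff)
  moreover have "(\<integral>x. partial i \<phi> x \<partial>lebesgue_on \<Omega>) = (\<integral>x. partial i \<phi> x \<partial>lborel)"
  proof -
    have "(\<integral>x. partial i \<phi> x \<partial>lebesgue_on \<Omega>) = (\<integral>x. indicator \<Omega> x *\<^sub>R partial i \<phi> x \<partial>lebesgue)"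
      using \<Omega> by (intro integral_restrict_space) (auto simp: borel_open)
    also have "(\<lambda>x. indicator \<Omega> x *\<^sub>R partial i \<phi> x) = partial i \<phi>"
      using L by (auto simp: fun_eq_iff indicator_def)
    also have "(\<integral>x. partial i \<phi> x \<partial>lebesgue) = (\<integral>x. partial i \<phi> x \<partial>lborel)"
      by (rule integral_completion) simp
    finally show ?thesis .
  qed
  ultimately show ?thesis by simp
qed

text \<open>
  Approximating indicator functions of boxes by \<open>box_bump\<close> shows that \<open>d\<close> has integral zero over every
  closed box inside \<open>\<Omega>\<close>. By Lebesgue's differentiation theorem for cubes the value of \<open>d\<close> at almost
  every point is a limit of averages over small cubes, and these are all zero.
\<close>

lemma fundamental_lemma_variations:
  fixes d :: "real^'n \<Rightarrow> real"
  assumes \<Omega>: "open \<Omega>" and d: "integrable (lebesgue_on \<Omega>) d"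
    and zero: "\<And>\<phi>. \<phi> \<in> test_functions \<Omega> \<Longrightarrow> (\<integral>x. d x * \<phi> x \<partial>lebesgue_on \<Omega>) = 0"
  shows "AE x in lebesgue_on \<Omega>. d x = 0"
proof -
  have [measurable]: "\<Omega> \<in> sets lebesgue" using \<Omega> by (simp add: borel_open)
  have dm [measurable]: "d \<in> borel_measurable (lebesgue_on \<Omega>)" using d by auto
  define f where "f x = indicator \<Omega> x *\<^sub>R d x" for x
  have f: "integrable lebesgue f"
    unfolding f_def using d by (subst (asm) integrable_restrict_space) auto
  have box0: "integral (cbox a b) f = 0" if ab: "cbox a b \<subseteq> \<Omega>" for a b
  proof -
    have "(\<lambda>n. \<integral>x. d x * box_bump a b n x \<partial>lebesgue_on \<Omega>)
        \<longlonglongrightarrow> (\<integral>x. d x * indicator (box a b) x \<partial>lebesgue_on \<Omega>)"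
    proof (rule integral_dominated_convergence)
      show "(\<lambda>x. d x * indicator (box a b) x) \<in> borel_measurable (lebesgue_on \<Omega>)"
        by (intro borel_measurable_times dm borel_measurable_indicator)
          (auto simp: sets_restrict_space intro!: image_eqI[of _ _ "box a b"]
            dest: subsetD[OF ab] subsetD[OF box_subset_cbox])
      show "(\<lambda>x. d x * box_bump a b n x) \<in> borel_measurable (lebesgue_on \<Omega>)" for n
        using borel_measurable_continuous_onI[OF
            test_function_continuous[OF box_bump_test_function[OF ab]]]
        by (intro borel_measurable_times dm measurable_restrict_space1 measurable_completion) simp
      show "integrable (lebesgue_on \<Omega>) (\<lambda>x. \<bar>d x\<bar>)" using d by simp
      show "AE x in lebesgue_on \<Omega>.
          (\<lambda>n. d x * box_bump a b n x) \<longlonglongrightarrow> d x * indicator (box a b) x"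
        by (intro AE_I2 tendsto_mult tendsto_const box_bump_tendsto_indicator)
      show "AE x in lebesgue_on \<Omega>. norm (d x * box_bump a b n x) \<le> \<bar>d x\<bar>" for n
        using box_bump_bounds[of a b n]
        by (intro AE_I2) (auto simp: abs_mult intro!: mult_left_le)
    qed
    then have "(\<integral>x. d x * indicator (box a b) x \<partial>lebesgue_on \<Omega>) = 0"
      using zero[OF box_bump_test_function[OF ab]] by (simp add: LIMSEQ_const_iff)
    then have i0: "(\<integral>x. indicator (box a b) x *\<^sub>R f x \<partial>lebesgue) = 0"
      by (subst (asm) integral_restrict_space) (auto simp: f_def mult_ac)
    have "integrable lebesgue (\<lambda>x. indicator (box a b) x *\<^sub>R f x)"
      using f by (intro integrable_mult_indicator) auto
    then have "((\<lambda>x. indicator (box a b) x *\<^sub>R f x) has_integral 0) UNIV"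
      using has_integral_integral_lebesgue i0 by metis
    then have "((\<lambda>x. if x \<in> box a b then f x else 0) has_integral 0) UNIV"
      by (rule has_integral_eq[rotated]) (auto simp: indicator_def)
    then have "(f has_integral 0) (box a b)"
      by (simp add: has_integral_restrict_UNIV)
    then show ?thesis
      using integral_open_interval[of a b f] by (simp add: integral_unique)
  qed
  have "f integrable_on cbox a b" for a b
    using integrable_on_lebesgue[OF f] integrable_on_subcbox by blast
  then obtain N where N: "negligible N"
    "\<And>x e. \<lbrakk>x \<notin> N; 0 < e\<rbrakk> \<Longrightarrow> \<exists>\<delta>>0. \<forall>h. 0 < h \<and> h < \<delta> \<longrightarrow>
        norm (integral (cbox x (x + h *\<^sub>R One)) f /\<^sub>R h ^ DIM(real^'n) - f x) < e"
    using integrable_ccontinuous_explicit[of f] by metis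
  have f0: "f x = 0" if x: "x \<in> \<Omega>" "x \<notin> N" for x
  proof (rule ccontr)
    assume "f x \<noteq> 0"
    then have "\<bar>f x\<bar> > 0" by simp
    then obtain \<delta> where \<delta>: "\<delta> > 0" "\<And>h. 0 < h \<Longrightarrow> h < \<delta> \<Longrightarrow>
        norm (integral (cbox x (x + h *\<^sub>R One)) f /\<^sub>R h ^ DIM(real^'n) - f x) < \<bar>f x\<bar>"
      using N(2)[OF x(2)] by blast
    obtain r where r: "r > 0" "ball x r \<subseteq> \<Omega>" using \<Omega> x(1) by (meson openE)
    \<comment> \<open>A cube of side less than r / |One| with corner x stays inside the ball of radius r.\<close>
    let ?S = "norm (One :: real^'n) + 1"
    have S: "?S > 0" by (simp add: add_nonneg_pos)
    define h where "h = min (\<delta> / 2) (r / (2 * ?S))"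
    have h: "h > 0" "h < \<delta>" using \<delta>(1) r(1) S by (auto simp: h_def)
    have "cbox x (x + h *\<^sub>R One) \<subseteq> ball x r"
    proof
      fix y assume y: "y \<in> cbox x (x + h *\<^sub>R One)"
      have "norm (y - x) \<le> norm (h *\<^sub>R (One :: real^'n))"
        using y h(1) by (intro norm_le_componentwise)
          (auto simp: mem_box inner_diff_left inner_add_left abs_if)
      also have "\<dots> < h * ?S" using h(1) by simp
      also have "\<dots> \<le> r / (2 * ?S) * ?S" using S by (intro mult_right_mono) (auto simp: h_def)
      also have "\<dots> \<le> r" using S r(1) by (simp add: field_simps)
      finally show "y \<in> ball x r" by (simp add: dist_norm norm_minus_commute)
    qed
    then show False using box0[of x "x + h *\<^sub>R One"] r(2) \<delta>(2)[OF h] by auto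
  qed
  have "AE x in lebesgue. x \<notin> N"
    using N(1) by (intro AE_not_in) (simp add: negligible_iff_null_sets)
  then have "AE x in lebesgue. x \<in> \<Omega> \<longrightarrow> d x = 0"
  proof eventually_elim
    case (elim x)
    then show ?case using f0[of x] by (auto simp: f_def)
  qed
  then show ?thesis by (subst AE_restrict_space_iff) auto
qed

section \<open>The graph of the weak gradient\<close>

lemma L2_eq_l2_space: "L2 \<Omega> = l2_space (lebesgue_on \<Omega>)"
  by (simp add: L2_def l2_space_def)

lemma l2_space_zero: "(\<lambda>x. 0) \<in> l2_space M"
  by (simp add: l2_space_def)

lemma l2_space_Pair_iff:
  "(\<lambda>x. (F x, G x)) \<in> l2_space M \<longleftrightarrow> F \<in> l2_space M \<and> G \<in> l2_space M"
proof safe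
  assume FG: "(\<lambda>x. (F x, G x)) \<in> l2_space M"
  have "(\<lambda>x. fst (F x, G x)) \<in> borel_measurable M" "(\<lambda>x. snd (F x, G x)) \<in> borel_measurable M"
    by (intro measurable_compose[OF l2_measurable[OF FG]] borel_measurable_continuous_onI
        continuous_intros)+
  then show "F \<in> l2_space M" "G \<in> l2_space M"
    by (auto intro!: l2_space_dominated[OF FG, of _ 1] AE_I2 simp: norm_fst_le norm_snd_le)
next
  assume F: "F \<in> l2_space M" and G: "G \<in> l2_space M"
  have "(\<lambda>x. (F x, 0 :: 'c)) \<in> l2_space M"
    using F by (intro l2_space_dominated[OF F, of _ 1]) (auto simp: norm_Pair)
  moreover have "(\<lambda>x. (0 :: 'b, G x)) \<in> l2_space M"
    using G by (intro l2_space_dominated[OF G, of _ 1]) (auto simp: norm_Pair)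
  ultimately have "(\<lambda>x. (F x, 0) + (0, G x)) \<in> l2_space M"
    by (rule l2_space_add)
  then show "(\<lambda>x. (F x, G x)) \<in> l2_space M" by simp
qed

lemma l2_norm_Pair_le:
  assumes F: "F \<in> l2_space M" and G: "G \<in> l2_space M"
  shows "l2_norm M (\<lambda>x. (F x, G x)) \<le> l2_norm M F + l2_norm M G"
proof -
  have "(\<lambda>x. (F x, G x)) = (\<lambda>x. (F x, 0)) + (\<lambda>x. (0, G x))"
    by (simp add: fun_eq_iff)
  moreover have "l2_norm M (\<lambda>x. (F x, 0 :: 'c)) = l2_norm M F" "l2_norm M (\<lambda>x. (0 :: 'b, G x)) = l2_norm M G"
    by (simp_all add: l2_norm_eq norm_Pair)
  ultimately show ?thesis
    using l2.snorm_triangle[of "\<lambda>x. (F x, 0 :: 'c)" M "\<lambda>x. (0 :: 'b, G x)"] F G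
    by (simp add: l2_space_Pair_iff l2_space_zero)
qed

lemma l2_norm_components_le:
  assumes "F \<in> l2_space M" "G \<in> l2_space M"
  shows "l2_norm M F \<le> l2_norm M (\<lambda>x. (F x, G x))"
    and "l2_norm M G \<le> l2_norm M (\<lambda>x. (F x, G x))"
  using l2_norm_dominated[of "\<lambda>x. (F x, G x)" M F 1] l2_norm_dominated[of "\<lambda>x. (F x, G x)" M G 1]
    assms norm_fst_le[of "F _" "G _"] norm_snd_le[of "G _" "F _"]
  by (simp_all add: l2_space_Pair_iff l2_measurable)

lemma l2_space_vec_iff:
  fixes G :: "'x \<Rightarrow> real^'n"
  shows "G \<in> l2_space M \<longleftrightarrow> (\<forall>i. (\<lambda>x. G x $ i) \<in> l2_space M)"
proof safe
  fix i
  assume G: "G \<in> l2_space M"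
  have "(\<lambda>x. G x \<bullet> axis i 1) \<in> borel_measurable M" using G by measurable
  then show "(\<lambda>x. G x $ i) \<in> l2_space M"
    using component_le_norm_cart[of "G _" i]
    by (intro l2_space_dominated[OF G, of _ 1]) (auto simp: inner_axis)
next
  assume c: "\<forall>i. (\<lambda>x. G x $ i) \<in> l2_space M"
  have "(\<lambda>x. (G x $ i) *\<^sub>R (axis i 1 :: real^'n)) \<in> l2_space M" for i
  proof (rule l2_space_dominated[of "\<lambda>x. G x $ i" _ _ 1])
    have [measurable]: "(\<lambda>x. G x $ i) \<in> borel_measurable M"
      using c by (auto dest: l2_measurable)
    show "(\<lambda>x. (G x $ i) *\<^sub>R (axis i 1 :: real^'n)) \<in> borel_measurable M" by measurable
  qed (use c in auto)
  then have "(\<lambda>x. \<Sum>i\<in>UNIV. (G x $ i) *\<^sub>R (axis i 1 :: real^'n)) \<in> l2_space M"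
    by (intro l2_space_sum)
  then show "G \<in> l2_space M" by (simp add: basis_expansion flip: scalar_mult_eq_scaleR)
qed

lemma test_function_l2:
  assumes "open \<Omega>" "bounded \<Omega>" and \<phi>: "\<phi> \<in> test_functions \<Omega>"
  shows "\<phi> \<in> l2_space (lebesgue_on \<Omega>)"
proof -
  interpret finite_measure "lebesgue_on \<Omega>"
    using assms by (intro finite_measure_lebesgue_on lmeasurable_open)
  obtain B where B: "B > 0" "\<forall>x. \<bar>\<phi> x\<bar> \<le> B" by (rule test_function_bounded[OF \<phi>])
  have m: "\<phi> \<in> borel_measurable (lebesgue_on \<Omega>)"
    using borel_measurable_continuous_onI[OF test_function_continuous[OF \<phi>]]
    by (intro measurable_restrict_space1 measurable_completion) simp
  have "integrable (lebesgue_on \<Omega>) (\<lambda>x. (norm (\<phi> x))\<^sup>2)"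
  proof (rule integrable_const_bound)
    show "AE x in lebesgue_on \<Omega>. norm ((norm (\<phi> x))\<^sup>2) \<le> B\<^sup>2"
      using B by (intro AE_I2) (simp add: abs_le_square_iff[symmetric])
    show "(\<lambda>x. (norm (\<phi> x))\<^sup>2) \<in> borel_measurable (lebesgue_on \<Omega>)" using m by measurable
  qed
  with m show ?thesis by (simp add: l2_space_def)
qed

definition grad :: "(real^'n \<Rightarrow> real) \<Rightarrow> real^'n \<Rightarrow> real^'n" where
  "grad \<phi> x = (\<chi> i. partial i \<phi> x)"

text \<open>
  A function together with its gradient, as one function with values in a Euclidean space: the
  \<open>H1\<close> norm of \<open>\<phi>\<close> is the \<open>L2\<close> norm of its jet.
\<close>

definition jet :: "(real^'n \<Rightarrow> real) \<Rightarrow> real^'n \<Rightarrow> real \<times> (real^'n)" where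
  "jet \<phi> x = (\<phi> x, grad \<phi> x)"

lemma jet_add:
  assumes "\<phi> \<in> test_functions \<Omega>" "\<psi> \<in> test_functions \<Omega>"
  shows "jet (\<lambda>x. \<phi> x + \<psi> x) = jet \<phi> + jet \<psi>"
  using assms[THEN test_function_differentiable]
  by (simp add: jet_def grad_def fun_eq_iff vec_eq_iff partial_add)

lemma jet_scale:
  assumes "\<phi> \<in> test_functions \<Omega>"
  shows "jet (\<lambda>x. c * \<phi> x) = c *\<^sub>R jet \<phi>"
  using assms[THEN test_function_differentiable]
  by (simp add: jet_def grad_def fun_eq_iff vec_eq_iff partial_mult[of "\<lambda>x. c"] partial_const)

lemma test_functions_scale: "\<phi> \<in> test_functions \<Omega> \<Longrightarrow> (\<lambda>x. c * \<phi> x) \<in> test_functions \<Omega>"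
  by (rule test_functions_mult[OF Ck_const])

locale bounded_open_domain =
  fixes \<Omega> :: "(real^'n) set"
  assumes open_domain: "open \<Omega>" and bounded_domain: "bounded \<Omega>"
begin

abbreviation M :: "(real^'n) measure" where "M \<equiv> lebesgue_on \<Omega>"

lemmas test_l2 = test_function_l2[OF open_domain bounded_domain]

lemma jet_l2: "\<phi> \<in> test_functions \<Omega> \<Longrightarrow> jet \<phi> \<in> l2_space M"
  unfolding jet_def[abs_def] l2_space_Pair_iff l2_space_vec_iff[of "grad \<phi>"]
  by (simp add: grad_def test_l2 partial_test_function)

text \<open>
  Orthogonality of \<open>(u, g)\<close> to these functions says precisely that \<open>g\<close> is the weak gradient of \<open>u\<close>
  (\<open>has_weak_grad_iff\<close>). Weak differentiability is thus a condition that passes to \<open>L2\<close> limits.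
\<close>

definition divergence_test :: "'n \<Rightarrow> (real^'n \<Rightarrow> real) \<Rightarrow> real^'n \<Rightarrow> real \<times> (real^'n)" where
  "divergence_test i \<phi> x = (partial i \<phi> x, \<phi> x *\<^sub>R axis i 1)"

lemma divergence_test_l2:
  assumes "\<phi> \<in> test_functions \<Omega>"
  shows "divergence_test i \<phi> \<in> l2_space M"
proof -
  have "(\<lambda>x. \<phi> x *\<^sub>R (axis i 1 :: real^'n)) \<in> l2_space M"
    unfolding l2_space_vec_iff
  proof
    fix j
    show "(\<lambda>x. (\<phi> x *\<^sub>R (axis i 1 :: real^'n)) $ j) \<in> l2_space M"
      using l2_space_scaleR[OF test_l2[OF assms], of "(axis i 1 :: real^'n) $ j"]
      by (simp add: mult.commute)
  qed
  then show ?thesis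
    using assms unfolding divergence_test_def[abs_def] l2_space_Pair_iff
    by (simp add: test_l2 partial_test_function)
qed

lemma has_weak_grad_iff:
  "has_weak_grad \<Omega> u g \<longleftrightarrow> (\<lambda>x. (u x, g x)) \<in> l2_space M \<and>
    (\<forall>\<phi>\<in>test_functions \<Omega>. \<forall>i. l2_inner M (\<lambda>x. (u x, g x)) (divergence_test i \<phi>) = 0)"
proof -
  have "(\<integral>x. u x * partial i \<phi> x \<partial>M) = - (\<integral>x. g x $ i * \<phi> x \<partial>M) \<longleftrightarrow>
      l2_inner M (\<lambda>x. (u x, g x)) (divergence_test i \<phi>) = 0"
    if u: "u \<in> l2_space M" and g: "g \<in> l2_space M" and \<phi>: "\<phi> \<in> test_functions \<Omega>" for \<phi> i
  proof -
    have "integrable M (\<lambda>x. u x * partial i \<phi> x)"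
      using l2_inner_integrable[OF u test_l2[OF partial_test_function[OF \<phi>]]] by simp
    moreover have "integrable M (\<lambda>x. g x $ i * \<phi> x)"
      using l2_inner_integrable[OF _ test_l2[OF \<phi>], of "\<lambda>x. g x $ i"] g
      by (simp add: l2_space_vec_iff)
    ultimately have "l2_inner M (\<lambda>x. (u x, g x)) (divergence_test i \<phi>)
        = (\<integral>x. u x * partial i \<phi> x \<partial>M) + (\<integral>x. g x $ i * \<phi> x \<partial>M)"
      by (simp add: l2_inner_def divergence_test_def inner_axis mult.commute)
    then show ?thesis by linarith
  qed
  then show ?thesis
    unfolding has_weak_grad_def L2_eq_l2_space l2_space_Pair_iff l2_space_vec_iff[of g, symmetric]
    by (auto simp: l2_space_vec_iff[of g])
qed

text \<open>
  By the product rule the pairing with a divergence test is the integral of a partial derivative of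
  a test function, which vanishes.
\<close>

lemma has_weak_grad_test_function:
  assumes \<phi>: "\<phi> \<in> test_functions \<Omega>"
  shows "has_weak_grad \<Omega> \<phi> (grad \<phi>)"
  unfolding has_weak_grad_iff
proof (intro conjI ballI allI)
  show "(\<lambda>x. (\<phi> x, grad \<phi> x)) \<in> l2_space M" using jet_l2[OF \<phi>] by (simp add: jet_def[abs_def])
  fix \<psi> i assume \<psi>: "\<psi> \<in> test_functions \<Omega>"
  have "l2_inner M (\<lambda>x. (\<phi> x, grad \<phi> x)) (divergence_test i \<psi>)
      = (\<integral>x. partial i (\<lambda>x. \<phi> x * \<psi> x) x \<partial>M)"
    using \<phi> \<psi> [THEN test_function_differentiable]
    by (simp add: partial_mult test_function_differentiable l2_inner_def divergence_test_def
        inner_axis grad_def mult.commute)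
  also have "\<dots> = 0"
    using \<phi> \<psi> by (intro integral_partial_test_function open_domain test_functions_mult)
      (auto simp: test_functions_def)
  finally show "l2_inner M (\<lambda>x. (\<phi> x, grad \<phi> x)) (divergence_test i \<psi>) = 0" .
qed

lemma has_weak_grad_diff:
  assumes "has_weak_grad \<Omega> u g" "has_weak_grad \<Omega> v h"
  shows "has_weak_grad \<Omega> (\<lambda>x. u x - v x) (\<lambda>x. g x - h x)"
proof -
  have eq: "(\<lambda>x. (u x - v x, g x - h x)) = (\<lambda>x. (u x, g x)) - (\<lambda>x. (v x, h x))"
    by (simp add: fun_eq_iff)
  show ?thesis
    using assms unfolding has_weak_grad_iff eq
    by (auto simp: l2.ip_diff divergence_test_l2)
qed

text \<open>
  The difference of two weak gradients of \<open>u\<close> is a weak gradient of zero. As \<open>\<Omega>\<close> has finite measure,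
  its components are integrable, and the fundamental lemma applies.
\<close>

lemma has_weak_grad_unique:
  assumes "has_weak_grad \<Omega> u g" "has_weak_grad \<Omega> u h"
  shows "AE x in M. g x = h x"
proof -
  interpret finite_measure M
    using open_domain bounded_domain by (intro finite_measure_lebesgue_on lmeasurable_open)
  have d: "has_weak_grad \<Omega> (\<lambda>x. u x - u x) (\<lambda>x. g x - h x)"
    using has_weak_grad_diff[OF assms] .
  have "AE x in M. (g x - h x) $ i = 0" for i
  proof (rule fundamental_lemma_variations[OF open_domain])
    have l2: "(\<lambda>x. (g x - h x) $ i) \<in> l2_space M"
      using d by (simp add: has_weak_grad_def L2_eq_l2_space)
    have "(\<lambda>x. 1::real) \<in> l2_space M" by (simp add: l2_space_def)
    from l2_inner_integrable[OF l2 this]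
    show "integrable M (\<lambda>x. (g x - h x) $ i)" by simp
    show "(\<integral>x. (g x - h x) $ i * \<phi> x \<partial>M) = 0" if "\<phi> \<in> test_functions \<Omega>" for \<phi>
      using d that by (simp add: has_weak_grad_def)
  qed
  then have "AE x in M. \<forall>i. (g x - h x) $ i = 0" by (simp add: AE_all_countable)
  then show ?thesis by eventually_elim (simp add: vec_eq_iff)
qed

lemma weak_grad_AE_eq:
  assumes "has_weak_grad \<Omega> u g"
  shows "AE x in M. weak_grad \<Omega> u x = g x"
  unfolding weak_grad_def
  using has_weak_grad_unique[OF someI[of "has_weak_grad \<Omega> u", OF assms] assms] .

lemma has_weak_grad_weak_grad: "u \<in> H1 \<Omega> \<Longrightarrow> has_weak_grad \<Omega> u (weak_grad \<Omega> u)"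
  unfolding H1_def weak_grad_def using someI[of "has_weak_grad \<Omega> u"] by blast

lemma H1_norm_eq_l2_norm:
  assumes "has_weak_grad \<Omega> u g"
  shows "H1_norm \<Omega> u = l2_norm M (\<lambda>x. (u x, g x))"
proof -
  have l2: "u \<in> l2_space M" "g \<in> l2_space M"
    using assms by (simp_all add: has_weak_grad_iff l2_space_Pair_iff)
  have "(\<integral>x. (norm (weak_grad \<Omega> u x))\<^sup>2 \<partial>M) = (\<integral>x. (norm (g x))\<^sup>2 \<partial>M)"
  proof (rule integral_cong_AE)
    have "u \<in> H1 \<Omega>" using assms by (auto simp: H1_def)
    from has_weak_grad_weak_grad[OF this] have "weak_grad \<Omega> u \<in> l2_space M"
      by (simp add: has_weak_grad_iff l2_space_Pair_iff)
    then show "(\<lambda>x. (norm (weak_grad \<Omega> u x))\<^sup>2) \<in> borel_measurable M" by measurable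
    show "(\<lambda>x. (norm (g x))\<^sup>2) \<in> borel_measurable M" using l2 by measurable
    show "AE x in M. (norm (weak_grad \<Omega> u x))\<^sup>2 = (norm (g x))\<^sup>2"
      using weak_grad_AE_eq[OF assms] by eventually_elim simp
  qed
  moreover have "integrable M (\<lambda>x. (u x)\<^sup>2)" "integrable M (\<lambda>x. (norm (g x))\<^sup>2)"
    using l2[THEN l2_square_integrable] by simp_all
  ultimately show ?thesis
    by (simp add: H1_norm_def l2_norm_eq norm_Pair)
qed

text \<open>
  The pairs \<open>(u, g)\<close> with \<open>u\<close> in \<open>H10 \<Omega>\<close> and \<open>g\<close> any version of its weak gradient, described as a closure
  in \<open>L2\<close> so that completeness is automatic.
\<close>

definition H10_graph :: "(real^'n \<Rightarrow> real \<times> (real^'n)) set" where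
  "H10_graph = l2.sclosure M (jet ` test_functions \<Omega>)"

text \<open>
  Jets of test functions are orthogonal to all divergence tests, and by the Cauchy-Schwarz inequality
  so are their limits.
\<close>

lemma H10_graph_has_weak_grad:
  assumes ug: "(\<lambda>x. (u x, g x)) \<in> H10_graph"
  shows "has_weak_grad \<Omega> u g"
  unfolding has_weak_grad_iff
proof (intro conjI ballI allI)
  let ?F = "\<lambda>x. (u x, g x)"
  show F: "?F \<in> l2_space M"
    using ug l2.sclosure_subset unfolding H10_graph_def by blast
  fix \<psi> i assume \<psi>: "\<psi> \<in> test_functions \<Omega>"
  let ?D = "divergence_test i \<psi>"
  have D: "?D \<in> l2_space M" by (rule divergence_test_l2[OF \<psi>])
  have "\<bar>l2_inner M ?F ?D\<bar> \<le> 0 + e" if e: "e > 0" for e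
  proof -
    have "e / (l2_norm M ?D + 1) > 0"
      using e l2.snorm_nonneg[OF D] by simp
    from l2.sclosureD[OF ug[unfolded H10_graph_def] this]
    obtain \<phi> where \<phi>: "\<phi> \<in> test_functions \<Omega>"
      and lt: "l2_norm M (?F - jet \<phi>) < e / (l2_norm M ?D + 1)"
      by auto
    have "l2_inner M (jet \<phi>) ?D = 0"
      using has_weak_grad_test_function[OF \<phi>] \<psi> by (simp add: has_weak_grad_iff jet_def[abs_def])
    then have "\<bar>l2_inner M ?F ?D\<bar> = \<bar>l2_inner M (?F - jet \<phi>) ?D\<bar>"
      using F D jet_l2[OF \<phi>] by (simp add: l2.ip_diff)
    also have "\<dots> \<le> l2_norm M (?F - jet \<phi>) * l2_norm M ?D"
      using F D jet_l2[OF \<phi>] by (intro l2.Cauchy_Schwarz) auto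
    also have "\<dots> \<le> l2_norm M (?F - jet \<phi>) * (l2_norm M ?D + 1)"
      using l2.snorm_nonneg[of "?F - jet \<phi>" M] F jet_l2[OF \<phi>] by (intro mult_left_mono) auto
    also have "\<dots> \<le> e"
      using lt l2.snorm_nonneg[OF D] by (simp add: pos_less_divide_eq)
    finally show ?thesis by simp
  qed
  then have "\<bar>l2_inner M ?F ?D\<bar> \<le> 0" by (rule field_le_epsilon)
  then show "l2_inner M ?F ?D = 0" by simp
qed

lemma H10_iff_graph:
  "u \<in> H10 \<Omega> \<longleftrightarrow> (\<lambda>x. (u x, weak_grad \<Omega> u x)) \<in> H10_graph" (is "_ \<longleftrightarrow> ?F \<in> _")
proof -
  have eq: "H1_norm \<Omega> (\<lambda>x. u x - \<phi> x) = l2_norm M (?F - jet \<phi>)"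
    if u: "u \<in> H1 \<Omega>" and \<phi>: "\<phi> \<in> test_functions \<Omega>" for \<phi>
    using H1_norm_eq_l2_norm[OF has_weak_grad_diff[OF has_weak_grad_weak_grad[OF u]
          has_weak_grad_test_function[OF \<phi>]]]
    by (simp add: fun_diff_def jet_def)
  have "u \<in> H1 \<Omega>" if "?F \<in> H10_graph"
    using H10_graph_has_weak_grad[OF that] by (auto simp: H1_def)
  moreover have "?F \<in> l2_space M" if "u \<in> H1 \<Omega>"
    using has_weak_grad_weak_grad[OF that] by (simp add: has_weak_grad_iff)
  ultimately show ?thesis
    using eq by (auto simp: H10_def H10_graph_def l2.sclosure_def)
qed

lemma H10_graph_cong_AE:
  assumes F: "F \<in> H10_graph" and G: "G \<in> l2_space M" and eq: "AE x in M. G x = F x"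
  shows "G \<in> H10_graph"
  unfolding H10_graph_def
proof (rule l2.sclosureI[OF G])
  fix e :: real assume "e > 0"
  from l2.sclosureD[OF F[unfolded H10_graph_def] this]
  obtain \<phi> where \<phi>: "\<phi> \<in> test_functions \<Omega>" and lt: "l2_norm M (F - jet \<phi>) < e"
    by auto
  have Fl: "F \<in> l2_space M" using F l2.sclosure_subset unfolding H10_graph_def by blast
  have "l2_norm M (G - jet \<phi>) \<le> 1 * l2_norm M (F - jet \<phi>)"
  proof (rule l2_norm_dominated)
    show "F - jet \<phi> \<in> l2_space M" using Fl jet_l2[OF \<phi>] by simp
    show "G - jet \<phi> \<in> borel_measurable M" using G jet_l2[OF \<phi>] by (intro l2_measurable) simp
    show "AE x in M. norm ((G - jet \<phi>) x) \<le> 1 * norm ((F - jet \<phi>) x)"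
      using eq by eventually_elim simp
  qed simp
  then show "\<exists>d\<in>jet ` test_functions \<Omega>. l2_norm M (G - d) < e"
    using lt \<phi> by (intro bexI[of _ "jet \<phi>"]) auto
qed

lemma H10_graph_imp_H10:
  assumes "(\<lambda>x. (u x, g x)) \<in> H10_graph"
  shows "u \<in> H10 \<Omega>" "AE x in M. weak_grad \<Omega> u x = g x"
proof -
  have wg: "has_weak_grad \<Omega> u g" by (rule H10_graph_has_weak_grad[OF assms])
  show ae: "AE x in M. weak_grad \<Omega> u x = g x" by (rule weak_grad_AE_eq[OF wg])
  have "u \<in> H1 \<Omega>" using wg by (auto simp: H1_def)
  then have "(\<lambda>x. (u x, weak_grad \<Omega> u x)) \<in> l2_space M"
    using has_weak_grad_weak_grad by (simp add: has_weak_grad_iff)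
  moreover have "AE x in M. (u x, weak_grad \<Omega> u x) = (u x, g x)"
    using ae by eventually_elim simp
  ultimately show "u \<in> H10 \<Omega>"
    unfolding H10_iff_graph by (rule H10_graph_cong_AE[OF assms])
qed

text \<open>
  The Hilbert space to which the Lax-Milgram theorem is applied.
\<close>

definition V_graph :: "(real^'n \<Rightarrow> (real \<times> (real^'n)) \<times> (real \<times> (real^'n))) set" where
  "V_graph = l2.sclosure M ((\<lambda>(\<phi>, \<psi>) x. (jet \<phi> x, jet \<psi> x)) ` (test_functions \<Omega> \<times> test_functions \<Omega>))"

lemma V_graph_jets_l2:
  "(\<lambda>(\<phi>, \<psi>) x. (jet \<phi> x, jet \<psi> x)) ` (test_functions \<Omega> \<times> test_functions \<Omega>) \<subseteq> l2_space M"
  by (auto simp: l2_space_Pair_iff intro: jet_l2)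

lemma V_graph_l2: "V_graph \<subseteq> l2_space M"
  unfolding V_graph_def by (rule l2.sclosure_subset)

lemma subspace_V_graph: "subspace V_graph"
  unfolding V_graph_def
proof (rule l2.subspace_sclosure[OF _ V_graph_jets_l2], rule subspaceI)
  let ?J = "\<lambda>(\<phi>, \<psi>) x. (jet \<phi> x, jet \<psi> x)" and ?T = "test_functions \<Omega>"
  have "?J (\<lambda>x. 0, \<lambda>x. 0) = 0"
    by (simp add: fun_eq_iff jet_def grad_def vec_eq_iff partial_const zero_prod_def)
  then show "0 \<in> ?J ` (?T \<times> ?T)"
    by (intro image_eqI[where x = "(\<lambda>x. 0, \<lambda>x. 0)"]) (auto simp: test_functions_zero)
  show "F + G \<in> ?J ` (?T \<times> ?T)" if F: "F \<in> ?J ` (?T \<times> ?T)" and G: "G \<in> ?J ` (?T \<times> ?T)" for F G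
  proof -
    obtain a b where 1: "a \<in> ?T" "b \<in> ?T" "F = ?J (a, b)" using F by auto
    obtain c d where 2: "c \<in> ?T" "d \<in> ?T" "G = ?J (c, d)" using G by auto
    have "F + G = ?J (\<lambda>x. a x + c x, \<lambda>x. b x + d x)"
      using 1 2 by (simp add: fun_eq_iff jet_add)
    then show ?thesis
      using 1 2 by (intro image_eqI[where x = "(\<lambda>x. a x + c x, \<lambda>x. b x + d x)"]) (auto intro: test_functions_add)
  qed
  show "c *\<^sub>R F \<in> ?J ` (?T \<times> ?T)" if F: "F \<in> ?J ` (?T \<times> ?T)" for c F
  proof -
    obtain a b where 1: "a \<in> ?T" "b \<in> ?T" "F = ?J (a, b)" using F by auto
    have "c *\<^sub>R F = ?J (\<lambda>x. c * a x, \<lambda>x. c * b x)"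
      using 1 by (simp add: fun_eq_iff jet_scale)
    then show ?thesis
      using 1 by (intro image_eqI[where x = "(\<lambda>x. c * a x, \<lambda>x. c * b x)"]) (auto intro: test_functions_scale)
  qed
qed

lemma scomplete_V_graph: "l2.scomplete M V_graph"
  unfolding V_graph_def by (rule l2.scomplete_sclosure[OF scomplete_l2_space V_graph_jets_l2])

lemma V_graph_Pair_iff:
  "(\<lambda>x. (F x, G x)) \<in> V_graph \<longleftrightarrow> F \<in> H10_graph \<and> G \<in> H10_graph"
proof
  assume FG: "(\<lambda>x. (F x, G x)) \<in> V_graph"
  then have l2: "F \<in> l2_space M" "G \<in> l2_space M"
    using V_graph_l2 by (auto simp: l2_space_Pair_iff)
  have "\<exists>\<phi>\<in>test_functions \<Omega>. \<exists>\<psi>\<in>test_functions \<Omega>.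
      l2_norm M (F - jet \<phi>) < e \<and> l2_norm M (G - jet \<psi>) < e" if "e > 0" for e
  proof -
    obtain \<phi> \<psi> where *: "\<phi> \<in> test_functions \<Omega>" "\<psi> \<in> test_functions \<Omega>"
      "l2_norm M ((\<lambda>x. (F x, G x)) - (\<lambda>x. (jet \<phi> x, jet \<psi> x))) < e"
      using l2.sclosureD[OF FG[unfolded V_graph_def] \<open>e > 0\<close>] by auto
    have "(\<lambda>x. (F x, G x)) - (\<lambda>x. (jet \<phi> x, jet \<psi> x)) = (\<lambda>x. ((F - jet \<phi>) x, (G - jet \<psi>) x))"
      by (simp add: fun_eq_iff)
    then have "l2_norm M (F - jet \<phi>) < e \<and> l2_norm M (G - jet \<psi>) < e"
      using l2_norm_components_le[of "F - jet \<phi>" M "G - jet \<psi>"] l2 jet_l2 * by force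
    with * show ?thesis by blast
  qed
  then show "F \<in> H10_graph \<and> G \<in> H10_graph"
    unfolding H10_graph_def using l2 by (auto intro!: l2.sclosureI)
next
  assume FG: "F \<in> H10_graph \<and> G \<in> H10_graph"
  then have l2: "F \<in> l2_space M" "G \<in> l2_space M"
    using l2.sclosure_subset unfolding H10_graph_def by blast+
  show "(\<lambda>x. (F x, G x)) \<in> V_graph"
    unfolding V_graph_def
  proof (rule l2.sclosureI)
    show "(\<lambda>x. (F x, G x)) \<in> l2_space M" using l2 by (simp add: l2_space_Pair_iff)
    fix e :: real assume "e > 0"
    then have e: "e / 2 > 0" by simp
    obtain \<phi> \<psi> where *: "\<phi> \<in> test_functions \<Omega>" "l2_norm M (F - jet \<phi>) < e / 2"
      "\<psi> \<in> test_functions \<Omega>" "l2_norm M (G - jet \<psi>) < e / 2"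
      using l2.sclosureD[OF FG[unfolded H10_graph_def, THEN conjunct1] e]
        l2.sclosureD[OF FG[unfolded H10_graph_def, THEN conjunct2] e] by auto
    have "(\<lambda>x. (F x, G x)) - (\<lambda>x. (jet \<phi> x, jet \<psi> x)) = (\<lambda>x. ((F - jet \<phi>) x, (G - jet \<psi>) x))"
      by (simp add: fun_eq_iff)
    moreover have "l2_norm M (\<lambda>x. ((F - jet \<phi>) x, (G - jet \<psi>) x)) < e"
      using l2_norm_Pair_le[of "F - jet \<phi>" M "G - jet \<psi>"] l2 jet_l2 * by force
    ultimately show "\<exists>d\<in>(\<lambda>(\<phi>, \<psi>) x. (jet \<phi> x, jet \<psi> x)) ` (test_functions \<Omega> \<times> test_functions \<Omega>).
        l2_norm M ((\<lambda>x. (F x, G x)) - d) < e"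
      using * by (intro bexI[of _ "\<lambda>x. (jet \<phi> x, jet \<psi> x)"]) auto
  qed
qed

end

section \<open>The coupled elliptic system\<close>

lemma Linfty_AE_le:
  assumes "c \<in> Linfty \<Omega>"
  shows "AE x in lebesgue_on \<Omega>. \<bar>c x\<bar> \<le> Linfty_norm \<Omega> c"
  using esssup_AE[of "\<lambda>x. ereal \<bar>c x\<bar>" "lebesgue_on \<Omega>"]
proof eventually_elim
  case (elim x)
  have "esssup (lebesgue_on \<Omega>) (\<lambda>x. ereal \<bar>c x\<bar>) < \<infinity>" using assms by (simp add: Linfty_def)
  with elim show ?case
    by (cases "esssup (lebesgue_on \<Omega>) (\<lambda>x. ereal \<bar>c x\<bar>)") (auto simp: Linfty_norm_def)
qed

lemma l2_space_Linfty_mult: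
  assumes c: "c \<in> Linfty \<Omega>" and u: "u \<in> l2_space (lebesgue_on \<Omega>)"
  shows "(\<lambda>x. c x * u x) \<in> l2_space (lebesgue_on \<Omega>)"
proof (rule l2_space_dominated[OF u])
  show "(\<lambda>x. c x * u x) \<in> borel_measurable (lebesgue_on \<Omega>)"
    using c u by (intro borel_measurable_times) (auto simp: Linfty_def l2_measurable)
  show "AE x in lebesgue_on \<Omega>. norm (c x * u x) \<le> Linfty_norm \<Omega> c * norm (u x)"
    using Linfty_AE_le[OF c] by eventually_elim (simp add: abs_mult mult_right_mono)
qed

text \<open>
  The essential infimum is defined as a supremum of essential lower bounds; it is itself
  such a bound because countably many of them, \<open>c - 1/(n+1)\<close>, suffice to reach \<open>c\<close>.
\<close>

lemma AE_ge_essinf: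
  assumes "ereal c \<le> essinf N (\<lambda>x. ereal (q x))"
  shows "AE x in N. c \<le> q x"
proof -
  have "AE x in N. c - inverse (real (Suc n)) \<le> q x" for n
  proof -
    have "ereal (c - inverse (real (Suc n))) < ereal c" by simp
    also have "\<dots> \<le> Sup {c. AE x in N. c \<le> ereal (q x)}" using assms by (simp add: essinf_def)
    finally obtain b where b: "AE x in N. b \<le> ereal (q x)" "ereal (c - inverse (real (Suc n))) < b"
      unfolding less_Sup_iff by auto
    from b(1) show ?thesis
    proof eventually_elim
      case (elim x)
      then show ?case using b(2) by (metis less_eq_ereal_def ereal_less_eq(3) order_trans)
    qed
  qed
  then have "AE x in N. \<forall>n. c - inverse (real (Suc n)) \<le> q x" by (simp add: AE_all_countable)
  then show ?thesis
  proof eventually_elim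
    case (elim x)
    have "(\<lambda>n. c - inverse (real (Suc n))) \<longlonglongrightarrow> c - 0"
      by (intro tendsto_intros LIMSEQ_inverse_real_of_nat)
    then show ?case using elim by (intro LIMSEQ_le_const2[where X = "\<lambda>n. c - inverse (real (Suc n))"]) auto
  qed
qed

lemma norm_matrix_vector_le:
  fixes P :: "real^'n^'n"
  assumes "\<And>i j. \<bar>P $ i $ j\<bar> \<le> k i j"
  shows "norm (P *v g) \<le> (\<Sum>i\<in>UNIV. \<Sum>j\<in>UNIV. k i j) * norm g"
proof -
  have "norm (P *v g) \<le> (\<Sum>i\<in>UNIV. \<bar>(P *v g) $ i\<bar>)" by (rule norm_le_l1_cart)
  also have "\<dots> \<le> (\<Sum>i\<in>UNIV. \<Sum>j\<in>UNIV. k i j * norm g)"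
  proof (rule sum_mono)
    fix i
    have "\<bar>(P *v g) $ i\<bar> \<le> (\<Sum>j\<in>UNIV. \<bar>P $ i $ j * g $ j\<bar>)"
      unfolding matrix_vector_mult_def by simp
    also have "\<dots> \<le> (\<Sum>j\<in>UNIV. k i j * norm g)"
      unfolding abs_mult using assms component_le_norm_cart[of g] order_trans[OF abs_ge_zero assms]
      by (intro sum_mono mult_mono) auto
    finally show "\<bar>(P *v g) $ i\<bar> \<le> (\<Sum>j\<in>UNIV. k i j * norm g)" .
  qed
  finally show ?thesis by (simp add: sum_distrib_right)
qed

text \<open>
  Young's inequality with weight \<open>\<alpha>\<close>: \<open>|u| |r| |g| \<le> \<alpha>/2 |g|^2 + |r|^2/(2 \<alpha>) u^2\<close>. Half of the ellipticity
  pays for the first summand, and the term \<open>B/(2 \<alpha>)\<close> in the bound for \<open>q\<close> pays for the second.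
\<close>

lemma coercive_pointwise:
  fixes r g :: "real^'n" and u q \<alpha> B :: real
  assumes \<alpha>: "\<alpha> > 0" and P: "\<alpha> * (g \<bullet> g) \<le> g \<bullet> (P *v g)"
    and q: "\<alpha> / 2 + B / (2 * \<alpha>) \<le> q" and r: "(norm r)\<^sup>2 \<le> B"
  shows "\<alpha> / 2 * (u\<^sup>2 + g \<bullet> g) \<le> u * (r \<bullet> g) + q * u\<^sup>2 + g \<bullet> (P *v g)"
proof -
  have "\<bar>u * (r \<bullet> g)\<bar> \<le> \<bar>u\<bar> * norm r * norm g"
    using Cauchy_Schwarz_ineq2[of r g] by (simp add: abs_mult mult.assoc mult_left_mono)
  also have "\<dots> \<le> \<alpha> / 2 * (norm g)\<^sup>2 + (norm r)\<^sup>2 / (2 * \<alpha>) * u\<^sup>2"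
  proof -
    have "0 \<le> (\<alpha> * norm g - \<bar>u\<bar> * norm r)\<^sup>2 / (2 * \<alpha>)" using \<alpha> by simp
    also have "\<dots> = \<alpha> / 2 * (norm g)\<^sup>2 + (norm r)\<^sup>2 / (2 * \<alpha>) * u\<^sup>2 - \<bar>u\<bar> * norm r * norm g"
      using \<alpha> by (simp add: power2_diff power_mult_distrib field_simps power2_eq_square)
    finally show ?thesis by simp
  qed
  also have "\<dots> \<le> \<alpha> / 2 * (norm g)\<^sup>2 + B / (2 * \<alpha>) * u\<^sup>2"
    using r \<alpha> by (intro add_left_mono mult_right_mono divide_right_mono) auto
  finally have 1: "- (\<alpha> / 2 * (g \<bullet> g) + B / (2 * \<alpha>) * u\<^sup>2) \<le> u * (r \<bullet> g)"
    by (simp add: power2_norm_eq_inner abs_le_iff)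
  have "(\<alpha> / 2 + B / (2 * \<alpha>)) * u\<^sup>2 \<le> q * u\<^sup>2" using q by (rule mult_right_mono) simp
  then show ?thesis using 1 P by (simp add: algebra_simps)
qed

text \<open>
  The operator \<open>T\<close> with \<open>a(u, v) = \<langle>T U, W\<rangle>\<close> for the jets \<open>U\<close> and \<open>W\<close> of \<open>u\<close> and \<open>v\<close>: convection and
  reaction terms are paired with the values of \<open>v\<close>, diffusion terms with its gradients.
\<close>

definition coeff_op :: "(real^'n \<Rightarrow> real^'n^'n) \<Rightarrow> (real^'n \<Rightarrow> real^'n) \<Rightarrow> (real^'n \<Rightarrow> real) \<Rightarrow> (real^'n \<Rightarrow> real)
    \<Rightarrow> (real^'n \<Rightarrow> (real \<times> (real^'n)) \<times> (real \<times> (real^'n)))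
    \<Rightarrow> real^'n \<Rightarrow> (real \<times> (real^'n)) \<times> (real \<times> (real^'n))" where
  "coeff_op P R q1 q2 F x = (case F x of ((u1, g1), (u2, g2)) \<Rightarrow>
     ((R x \<bullet> g1 + (q1 x * u1 + q2 x * u2), P x *v g1),
      (R x \<bullet> g2 + (q1 x * u2 - q2 x * u1), P x *v g2)))"

lemma coeff_op_add: "coeff_op P R q1 q2 (F + G) = coeff_op P R q1 q2 F + coeff_op P R q1 q2 G"
  by (auto simp: coeff_op_def fun_eq_iff split_beta inner_add_right matrix_vector_right_distrib
      algebra_simps)

lemma coeff_op_scaleR: "coeff_op P R q1 q2 (c *\<^sub>R F) = c *\<^sub>R coeff_op P R q1 q2 F"
  by (auto simp: coeff_op_def fun_eq_iff split_beta matrix_vector_mult_scaleR algebra_simps)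

context bounded_open_domain
begin

definition V_jet :: "(real^'n \<Rightarrow> real) \<times> (real^'n \<Rightarrow> real)
    \<Rightarrow> real^'n \<Rightarrow> (real \<times> (real^'n)) \<times> (real \<times> (real^'n))" where
  "V_jet u x = ((fst u x, weak_grad \<Omega> (fst u) x), (snd u x, weak_grad \<Omega> (snd u) x))"

lemma V_jet_graph: "u \<in> V \<Omega> \<Longrightarrow> V_jet u \<in> V_graph"
  unfolding V_jet_def[abs_def] V_graph_Pair_iff by (auto simp: V_def H10_iff_graph)

text \<open>
  An element of \<open>V_graph\<close> may carry other versions of the weak gradients than the ones chosen by
  \<open>weak_grad\<close>; the jet of the underlying pair agrees with it almost everywhere.
\<close>

lemma V_graph_AE_V_jet:
  assumes "F \<in> V_graph"
  obtains u where "u \<in> V \<Omega>" "AE x in M. V_jet u x = F x"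
proof -
  define u1 g1 u2 g2 where "u1 x = fst (fst (F x))" and "g1 x = snd (fst (F x))"
    and "u2 x = fst (snd (F x))" and "g2 x = snd (snd (F x))" for x
  have "F = (\<lambda>x. ((u1 x, g1 x), (u2 x, g2 x)))"
    by (simp add: u1_def u2_def g1_def g2_def)
  with assms have "(\<lambda>x. (u1 x, g1 x)) \<in> H10_graph" "(\<lambda>x. (u2 x, g2 x)) \<in> H10_graph"
    by (auto simp: V_graph_Pair_iff)
  note 1 = H10_graph_imp_H10[OF this(1)] and 2 = H10_graph_imp_H10[OF this(2)]
  show ?thesis
  proof (rule that[of "(u1, u2)"])
    show "(u1, u2) \<in> V \<Omega>" using 1 2 by (simp add: V_def)
    show "AE x in M. V_jet (u1, u2) x = F x"
      using 1(2) 2(2)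
    proof eventually_elim
      case (elim x)
      then have "V_jet (u1, u2) x = ((u1 x, g1 x), (u2 x, g2 x))" by (simp add: V_jet_def)
      then show ?case by (simp add: u1_def u2_def g1_def g2_def)
    qed
  qed
qed

lemma L2_pairing_eq_l2_inner:
  "L2_pairing \<Omega> f v = l2_inner M (\<lambda>x. ((fst f x, 0), (snd f x, 0))) (V_jet v)"
  by (simp add: L2_pairing_def l2_inner_def V_jet_def split_beta)

end

locale coupled_system = bounded_open_domain \<Omega> for \<Omega> :: "(real^'n) set" +
  fixes P :: "real ^ 'n \<Rightarrow> real ^ 'n ^ 'n" and R :: "real ^ 'n \<Rightarrow> real ^ 'n"
    and q1 q2 :: "real ^ 'n \<Rightarrow> real" and \<alpha> :: real
  assumes P_Linfty: "\<And>i j. (\<lambda>x. P x $ i $ j) \<in> Linfty \<Omega>"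
    and R_Linfty: "\<And>k. (\<lambda>x. R x $ k) \<in> Linfty \<Omega>"
    and q1_Linfty: "q1 \<in> Linfty \<Omega>" and q2_Linfty: "q2 \<in> Linfty \<Omega>"
    and \<alpha>_pos: "\<alpha> > 0"
    and elliptic: "AE x in lebesgue_on \<Omega>. \<forall>A. A \<bullet> (P x *v A) \<ge> \<alpha> * (A \<bullet> A)"
    and q1_large: "essinf (lebesgue_on \<Omega>) (\<lambda>x. ereal (q1 x))
           \<ge> ereal (\<alpha> / 2 + (\<Sum>k\<in>UNIV. (Linfty_norm \<Omega> (\<lambda>x. R x $ k))\<^sup>2) / (2 * \<alpha>))"
begin

abbreviation T where "T \<equiv> coeff_op P R q1 q2"

lemma P_l2:
  assumes "g \<in> l2_space M" shows "(\<lambda>x. P x *v g x) \<in> l2_space M"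
  unfolding l2_space_vec_iff
proof
  fix i
  have "(\<lambda>x. \<Sum>j\<in>UNIV. P x $ i $ j * g x $ j) \<in> l2_space M"
    using assms l2_space_vec_iff[of g M]
    by (intro l2_space_sum l2_space_Linfty_mult P_Linfty) auto
  then show "(\<lambda>x. (P x *v g x) $ i) \<in> l2_space M" by (simp add: matrix_vector_mult_def)
qed

lemma R_l2:
  assumes "g \<in> l2_space M" shows "(\<lambda>x. R x \<bullet> g x) \<in> l2_space M"
proof -
  have "(\<lambda>x. \<Sum>j\<in>UNIV. R x $ j * g x $ j) \<in> l2_space M"
    using assms l2_space_vec_iff[of g M]
    by (intro l2_space_sum l2_space_Linfty_mult R_Linfty) auto
  then show ?thesis by (simp add: inner_vec_def)
qed

lemma q_l2:
  assumes "u \<in> l2_space M" "v \<in> l2_space M"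
  shows "(\<lambda>x. q1 x * u x + q2 x * v x) \<in> l2_space M"
    and "(\<lambda>x. q1 x * u x - q2 x * v x) \<in> l2_space M"
  using l2_space_add[OF l2_space_Linfty_mult[OF q1_Linfty assms(1)]
      l2_space_Linfty_mult[OF q2_Linfty assms(2)]]
    l2_space_add[OF l2_space_Linfty_mult[OF q1_Linfty assms(1)]
      l2_space_scaleR[OF l2_space_Linfty_mult[OF q2_Linfty assms(2)], of "-1"]]
  by simp_all

lemma T_l2:
  assumes F: "F \<in> l2_space M"
  shows "T F \<in> l2_space M"
proof -
  define u1 g1 u2 g2 where "u1 x = fst (fst (F x))" and "g1 x = snd (fst (F x))"
    and "u2 x = fst (snd (F x))" and "g2 x = snd (snd (F x))" for x
  have Feq: "F = (\<lambda>x. ((u1 x, g1 x), (u2 x, g2 x)))"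
    by (simp add: u1_def u2_def g1_def g2_def)
  with F have l2: "u1 \<in> l2_space M" "g1 \<in> l2_space M" "u2 \<in> l2_space M" "g2 \<in> l2_space M"
    by (auto simp: l2_space_Pair_iff)
  have "T F = (\<lambda>x. ((R x \<bullet> g1 x + (q1 x * u1 x + q2 x * u2 x), P x *v g1 x),
      (R x \<bullet> g2 x + (q1 x * u2 x - q2 x * u1 x), P x *v g2 x)))"
    by (simp add: Feq coeff_op_def fun_eq_iff)
  then show ?thesis
    using l2 by (simp add: l2_space_Pair_iff l2_space_add P_l2 R_l2 q_l2)
qed

lemma T_bounded:
  obtains C where "\<forall>F\<in>l2_space M. l2_norm M (T F) \<le> C * l2_norm M F"
proof -
  define kP kR k1 k2 where "kP = (\<Sum>i\<in>UNIV. \<Sum>j\<in>UNIV. \<bar>Linfty_norm \<Omega> (\<lambda>x. P x $ i $ j)\<bar>)"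
    and "kR = (\<Sum>k\<in>UNIV. \<bar>Linfty_norm \<Omega> (\<lambda>x. R x $ k)\<bar>)"
    and "k1 = \<bar>Linfty_norm \<Omega> q1\<bar>" and "k2 = \<bar>Linfty_norm \<Omega> q2\<bar>"
  have k0: "kP \<ge> 0" "kR \<ge> 0" "k1 \<ge> 0" "k2 \<ge> 0"
    by (auto simp: kP_def kR_def k1_def k2_def intro!: sum_nonneg)
  have bd: "AE x in M. (\<forall>i j. \<bar>P x $ i $ j\<bar> \<le> \<bar>Linfty_norm \<Omega> (\<lambda>x. P x $ i $ j)\<bar>) \<and>
      (\<forall>k. \<bar>R x $ k\<bar> \<le> \<bar>Linfty_norm \<Omega> (\<lambda>x. R x $ k)\<bar>) \<and> \<bar>q1 x\<bar> \<le> k1 \<and> \<bar>q2 x\<bar> \<le> k2"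
    (is "AE x in M. ?b x")
  proof -
    have *: "AE x in M. \<bar>c x\<bar> \<le> \<bar>Linfty_norm \<Omega> c\<bar>" if "c \<in> Linfty \<Omega>" for c
      using Linfty_AE_le[OF that] by eventually_elim simp
    show ?thesis
      unfolding k1_def k2_def
      by (simp add: AE_all_countable * P_Linfty R_Linfty q1_Linfty q2_Linfty)
  qed
  have est: "norm (T F x) \<le> 2 * (kR + k1 + k2 + kP) * norm (F x)" if b: "?b x" for F x
  proof -
    obtain u1 g1 u2 g2 where F: "F x = ((u1, g1), (u2, g2))" by (metis surj_pair)
    let ?N = "norm (F x)"
    have le1: "norm (u1, g1) \<le> ?N" and le2: "norm (u2, g2) \<le> ?N"
      unfolding F by (rule norm_fst_le, rule norm_snd_le)
    have le: "\<bar>u1\<bar> \<le> ?N" "norm g1 \<le> ?N" "\<bar>u2\<bar> \<le> ?N" "norm g2 \<le> ?N"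
      using order_trans[OF norm_fst_le le1] order_trans[OF norm_snd_le le1]
        order_trans[OF norm_fst_le le2] order_trans[OF norm_snd_le le2] by simp_all
    have Rle: "\<bar>R x \<bullet> g\<bar> \<le> kR * ?N" if "norm g \<le> ?N" for g
    proof -
      have "norm (R x) \<le> (\<Sum>k\<in>UNIV. \<bar>R x $ k\<bar>)" by (rule norm_le_l1_cart)
      also have "\<dots> \<le> kR" unfolding kR_def using b by (intro sum_mono) auto
      finally have "norm (R x) * norm g \<le> kR * ?N" using that k0 by (intro mult_mono) auto
      then show ?thesis using Cauchy_Schwarz_ineq2[of "R x" g] by linarith
    qed
    have Ple: "norm (P x *v g) \<le> kP * ?N" if "norm g \<le> ?N" for g
    proof -
      have "norm (P x *v g) \<le> kP * norm g"
        unfolding kP_def using b by (intro norm_matrix_vector_le) auto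
      also have "\<dots> \<le> kP * ?N" using that k0 by (intro mult_left_mono)
      finally show ?thesis .
    qed
    have qle: "\<bar>q1 x * u\<bar> \<le> k1 * ?N" "\<bar>q2 x * u\<bar> \<le> k2 * ?N" if "\<bar>u\<bar> \<le> ?N" for u
      unfolding abs_mult using b that k0 by (auto intro: mult_mono)
    have "norm (T F x) \<le> norm (R x \<bullet> g1 + (q1 x * u1 + q2 x * u2)) + norm (P x *v g1)
        + (norm (R x \<bullet> g2 + (q1 x * u2 - q2 x * u1)) + norm (P x *v g2))"
      unfolding coeff_op_def F prod.case
      by (intro order_trans[OF norm_Pair_le] add_mono norm_Pair_le)
    also have "\<dots> \<le> (kR * ?N + (k1 * ?N + k2 * ?N)) + kP * ?N + ((kR * ?N + (k1 * ?N + k2 * ?N)) + kP * ?N)"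
      using Rle[OF le(2)] Rle[OF le(4)] Ple[OF le(2)] Ple[OF le(4)] qle[OF le(1)] qle[OF le(3)]
      unfolding real_norm_def by linarith
    also have "\<dots> = 2 * (kR + k1 + k2 + kP) * ?N" by (simp add: algebra_simps)
    finally show ?thesis .
  qed
  have "l2_norm M (T F) \<le> 2 * (kR + k1 + k2 + kP) * l2_norm M F" if F: "F \<in> l2_space M" for F
  proof (rule l2_norm_dominated[OF F l2_measurable[OF T_l2[OF F]]])
    show "AE x in M. norm (T F x) \<le> 2 * (kR + k1 + k2 + kP) * norm (F x)"
      using bd by eventually_elim (rule est)
  qed (use k0 in simp)
  then show ?thesis using that by blast
qed

text \<open>
  In \<open>T F x \<bullet> F x\<close> the contributions \<open>q2 u2 u1\<close> and \<open>- q2 u1 u2\<close> cancel, so the two equations decouple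
  and \<open>coercive_pointwise\<close> applies to each of them.
\<close>

lemma T_coercive:
  assumes F: "F \<in> l2_space M"
  shows "\<alpha> / 2 * l2_inner M F F \<le> l2_inner M (T F) F"
proof -
  let ?B = "\<Sum>k\<in>UNIV. (Linfty_norm \<Omega> (\<lambda>x. R x $ k))\<^sup>2"
  have R_AE: "AE x in M. \<forall>k. \<bar>R x $ k\<bar> \<le> Linfty_norm \<Omega> (\<lambda>x. R x $ k)"
    by (simp add: AE_all_countable Linfty_AE_le R_Linfty)
  have "AE x in M. \<alpha> / 2 * (F x \<bullet> F x) \<le> T F x \<bullet> F x"
    using R_AE elliptic AE_ge_essinf[OF q1_large]
  proof eventually_elim
    case (elim x)
    obtain u1 g1 u2 g2 where Fx: "F x = ((u1, g1), (u2, g2))" by (metis surj_pair)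
    have "(norm (R x))\<^sup>2 = (\<Sum>k\<in>UNIV. (R x $ k)\<^sup>2)"
      unfolding power2_norm_eq_inner inner_vec_def by (simp add: power2_eq_square)
    also have "\<dots> \<le> ?B"
      using elim(1) by (intro sum_mono) (metis abs_ge_zero power2_abs power_mono)
    finally have R: "(norm (R x))\<^sup>2 \<le> ?B" .
    note c = coercive_pointwise[OF \<alpha>_pos elim(2)[rule_format] elim(3) R]
    have "T F x \<bullet> F x = (u1 * (R x \<bullet> g1) + q1 x * u1\<^sup>2 + g1 \<bullet> (P x *v g1))
        + (u2 * (R x \<bullet> g2) + q1 x * u2\<^sup>2 + g2 \<bullet> (P x *v g2))"
      by (simp add: coeff_op_def Fx inner_commute power2_eq_square algebra_simps)
    moreover have "F x \<bullet> F x = (u1\<^sup>2 + g1 \<bullet> g1) + (u2\<^sup>2 + g2 \<bullet> g2)"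
      by (simp add: Fx power2_eq_square)
    ultimately show ?case using c[of u1 g1] c[of u2 g2] by (simp add: algebra_simps)
  qed
  then have "(\<integral>x. \<alpha> / 2 * (F x \<bullet> F x) \<partial>M) \<le> l2_inner M (T F) F"
    unfolding l2_inner_def using F T_l2[OF F]
    by (intro integral_mono_AE) (simp_all add: l2_inner_integrable)
  then show ?thesis by (simp add: l2_inner_def)
qed

lemma bform_eq_l2_inner:
  assumes u: "u \<in> V \<Omega>" and v: "v \<in> V \<Omega>"
  shows "bform \<Omega> P R q1 q2 u v = l2_inner M (T (V_jet u)) (V_jet v)"
proof -
  obtain u1 u2 v1 v2 where uv: "u = (u1, u2)" "v = (v1, v2)" by (metis surj_pair)
  define g1 g2 h1 h2 where "g1 = weak_grad \<Omega> u1" and "g2 = weak_grad \<Omega> u2"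
    and "h1 = weak_grad \<Omega> v1" and "h2 = weak_grad \<Omega> v2"
  have "V_jet u \<in> l2_space M" "V_jet v \<in> l2_space M"
    using V_jet_graph u v V_graph_l2 by blast+
  then have l2: "u1 \<in> l2_space M" "u2 \<in> l2_space M" "g1 \<in> l2_space M" "g2 \<in> l2_space M"
    "v1 \<in> l2_space M" "v2 \<in> l2_space M" "h1 \<in> l2_space M" "h2 \<in> l2_space M"
    by (simp_all add: V_jet_def[abs_def] uv l2_space_Pair_iff g1_def g2_def h1_def h2_def)
  have int: "integrable M (\<lambda>x. h1 x \<bullet> (P x *v g1 x))" "integrable M (\<lambda>x. h2 x \<bullet> (P x *v g2 x))"
    "integrable M (\<lambda>x. v1 x \<bullet> (R x \<bullet> g1 x))" "integrable M (\<lambda>x. v2 x \<bullet> (R x \<bullet> g2 x))"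
    "integrable M (\<lambda>x. (q1 x * u1 x + q2 x * u2 x) \<bullet> v1 x)"
    "integrable M (\<lambda>x. (q1 x * u2 x - q2 x * u1 x) \<bullet> v2 x)"
    by (intro l2_inner_integrable P_l2 R_l2 q_l2 l2)+
  let ?a = "\<lambda>x. h1 x \<bullet> (P x *v g1 x) + h2 x \<bullet> (P x *v g2 x)"
  let ?b = "\<lambda>x. v1 x * (R x \<bullet> g1 x) + v2 x * (R x \<bullet> g2 x)"
  let ?c = "\<lambda>x. (q1 x * u1 x + q2 x * u2 x) * v1 x + (q1 x * u2 x - q2 x * u1 x) * v2 x"
  have abc: "integrable M ?a" "integrable M ?b" "integrable M ?c"
    using int by simp_all
  have "bform \<Omega> P R q1 q2 u v = (\<integral>x. ?a x \<partial>M) + (\<integral>x. ?b x \<partial>M) + (\<integral>x. ?c x \<partial>M)"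
    by (simp add: bform_def uv g1_def g2_def h1_def h2_def)
  also have "\<dots> = (\<integral>x. ?a x + ?b x + ?c x \<partial>M)"
    using abc by (simp only: Bochner_Integration.integral_add Bochner_Integration.integrable_add)
  also have "\<dots> = l2_inner M (T (V_jet u)) (V_jet v)"
    unfolding l2_inner_def
    by (intro Bochner_Integration.integral_cong refl)
      (simp add: coeff_op_def V_jet_def uv g1_def g2_def h1_def h2_def inner_commute algebra_simps)
  finally show ?thesis .
qed

text \<open>
  Existence is the Lax-Milgram theorem on \<open>V_graph\<close>. For uniqueness, the difference of the jets of
  two solutions is orthogonal to its image under \<open>T\<close>, hence has norm zero by coercivity.
\<close>

theorem weak_solution_exists_unique:
  assumes f: "f \<in> L2 \<Omega> \<times> L2 \<Omega>"
  shows "\<exists>u\<in>V \<Omega>. (\<forall>v\<in>V \<Omega>. bform \<Omega> P R q1 q2 u v = L2_pairing \<Omega> f v) \<and>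
    (\<forall>w\<in>V \<Omega>. (\<forall>v\<in>V \<Omega>. bform \<Omega> P R q1 q2 w v = L2_pairing \<Omega> f v) \<longrightarrow> ae_eq \<Omega> w u)"
proof -
  let ?f = "\<lambda>x. ((fst f x, 0 :: real^'n), (snd f x, 0 :: real^'n))"
  have fl2: "?f \<in> l2_space M"
    using f by (auto simp: l2_space_Pair_iff l2_space_zero L2_eq_l2_space)
  have jet_l2: "V_jet u \<in> l2_space M" if "u \<in> V \<Omega>" for u
    using V_jet_graph[OF that] V_graph_l2 by blast
  obtain C where C: "\<forall>F\<in>l2_space M. l2_norm M (T F) \<le> C * l2_norm M F" by (rule T_bounded)
  obtain U where U: "U \<in> V_graph" "\<And>G. G \<in> V_graph \<Longrightarrow> l2_inner M (T U) G = l2_inner M ?f G"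
  proof (rule l2.Lax_Milgram[OF subspace_V_graph V_graph_l2 scomplete_V_graph])
    show "T u \<in> l2_space M" if "u \<in> V_graph" for u using that V_graph_l2 T_l2 by blast
    show "l2_norm M (T u) \<le> C * l2_norm M u" if "u \<in> V_graph" for u using that V_graph_l2 C by blast
    show "\<alpha> / 2 * l2_inner M u u \<le> l2_inner M (T u) u" if "u \<in> V_graph" for u
      using that V_graph_l2 T_coercive by blast
    show "0 < \<alpha> / 2" using \<alpha>_pos by simp
  qed (use fl2 in \<open>auto simp: coeff_op_add coeff_op_scaleR\<close>)
  obtain u where u: "u \<in> V \<Omega>" "AE x in M. V_jet u x = U x"
    by (rule V_graph_AE_V_jet[OF U(1)])
  have sol: "bform \<Omega> P R q1 q2 u v = L2_pairing \<Omega> f v" if v: "v \<in> V \<Omega>" for v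
  proof -
    have Ul2: "U \<in> l2_space M" using U(1) V_graph_l2 by blast
    have "l2_inner M (T (V_jet u)) (V_jet v) = l2_inner M (T U) (V_jet v)"
      unfolding l2_inner_def
    proof (rule integral_cong_AE)
      show "AE x in M. T (V_jet u) x \<bullet> V_jet v x = T U x \<bullet> V_jet v x"
        using u(2) by eventually_elim (simp add: coeff_op_def)
    qed (use T_l2[OF jet_l2[OF u(1)]] T_l2[OF Ul2] jet_l2[OF v] in
        \<open>auto intro!: borel_measurable_inner l2_measurable\<close>)
    then show ?thesis
      using U(2)[OF V_jet_graph[OF v]]
      by (simp add: bform_eq_l2_inner[OF u(1) v] L2_pairing_eq_l2_inner)
  qed
  have uniq: "ae_eq \<Omega> w u"
    if w: "w \<in> V \<Omega>" and ws: "\<forall>v\<in>V \<Omega>. bform \<Omega> P R q1 q2 w v = L2_pairing \<Omega> f v" for w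
  proof -
    let ?D = "V_jet w - V_jet u"
    have Tdiff: "T ?D = T (V_jet w) - T (V_jet u)"
      using coeff_op_add[of P R q1 q2 ?D "V_jet u"] by simp
    have D: "?D \<in> l2_space M" using jet_l2 w u(1) by simp
    have eq: "l2_inner M (T ?D) (V_jet v) = 0" if v: "v \<in> V \<Omega>" for v
      using ws sol v w u(1) jet_l2 T_l2
      by (simp add: Tdiff l2.ip_diff bform_eq_l2_inner)
    have "\<alpha> / 2 * l2_inner M ?D ?D \<le> l2_inner M (T ?D) ?D" by (rule T_coercive[OF D])
    also have "\<dots> = 0"
      using eq[OF w] eq[OF u(1)] jet_l2 w u(1) T_l2[OF D] by (simp add: l2.ip_diff_right)
    finally have "l2_inner M ?D ?D = 0"
      using \<alpha>_pos l2.ip_nonneg[OF D] by (simp add: mult_le_0_iff)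
    then have "AE x in M. ?D x = 0"
      by (intro l2_norm_eq_0_AE[OF D]) (simp add: l2.snorm_def)
    then show ?thesis
      unfolding ae_eq_def by eventually_elim (simp add: V_jet_def zero_prod_def)
  qed
  show ?thesis using u(1) sol uniq by blast
qed

end

theorem theorem1:
  fixes \<Omega> :: "(real ^ 'n) set"
    and P :: "real ^ 'n \<Rightarrow> real ^ 'n ^ 'n"
    and R :: "real ^ 'n \<Rightarrow> real ^ 'n"
    and q1 q2 :: "real ^ 'n \<Rightarrow> real"
    and \<alpha> :: real
    and f :: "'n fpair"
  assumes "open \<Omega>" and "bounded \<Omega>"
    and "\<And>i j. (\<lambda>x. P x $ i $ j) \<in> Linfty \<Omega>"
    and "\<And>k. (\<lambda>x. R x $ k) \<in> Linfty \<Omega>"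
    and "q1 \<in> Linfty \<Omega>" and "q2 \<in> Linfty \<Omega>"
    and "AE x in lebesgue_on \<Omega>. transpose (P x) = P x"
    and "\<alpha> > 0"
    and "AE x in lebesgue_on \<Omega>. \<forall>A. A \<bullet> (P x *v A) \<ge> \<alpha> * (A \<bullet> A)"
    and "essinf (lebesgue_on \<Omega>) (\<lambda>x. ereal (q1 x))
           \<ge> ereal (\<alpha> / 2 + (\<Sum>k\<in>UNIV. (Linfty_norm \<Omega> (\<lambda>x. R x $ k))\<^sup>2) / (2 * \<alpha>))"
    and "f \<in> L2 \<Omega> \<times> L2 \<Omega>"
  shows "\<exists>u\<in>V \<Omega>. (\<forall>v\<in>V \<Omega>. bform \<Omega> P R q1 q2 u v = L2_pairing \<Omega> f v) \<and>
    (\<forall>w\<in>V \<Omega>. (\<forall>v\<in>V \<Omega>. bform \<Omega> P R q1 q2 w v = L2_pairing \<Omega> f v) \<longrightarrow> ae_eq \<Omega> w u)"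
proof -
  interpret coupled_system \<Omega> P R q1 q2 \<alpha>
    by standard (use assms in blast)+
  show ?thesis by (rule weak_solution_exists_unique) fact
qed

end
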